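(* Let $n\ge 1$ be the dimension, $0<\lambda\le\Lambda$, $\mu\ge0$. There is a constant $C>0$ depending only on $n,\lambda,\Lambda,\mu$ such that the following holds. Let $R>0$, $0\le\theta\le1$, $f^{\pm}\in C(B_R^{\pm}\cup T_R)$, $g\in C(T_R)$, and let $u\in\overline{S}(\lambda,\Lambda,\mu,\theta;f^{+},f^{-},g)$ in $B_R$, with $u\in LSC(\overline{B_R})$. Then $$\sup_{B_R}u_{-}\le\sup_{\partial B_R}u_{-}+CR\left(\|f^{+}_{+}\|_{L^n(\{u=\Gamma_u\}\cap B_R^{+})}+\|f^{-}_{+}\|_{L^n(\{u=\Gamma_u\}\cap B_R^{-})}+\|g_{+}\|_{L^{\infty}(T_R)}\right),$$ where $\Gamma_u$ denotes the convex envelope of $-u_{-}\chi_{B_R}$ in the ball $B_{2R}$.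
   Context: Notation. Points are $x=(x',x_n)\in\mathbb{R}^{n-1}\times\mathbb{R}$; $B_R\subset\mathbb{R}^n$ is the open ball of radius $R$ centered at $0$, $B_R^{\pm}=B_R\cap\{\pm x_n>0\}$, $T_R=B_R\cap\{x_n=0\}$. Superscripts $\pm$ refer to the two sides: for $u$ on an open set $\Omega$, with $\Omega^{\pm}=\Omega\cap\{\pm x_n>0\}$, $T=\Omega\cap\{x_n=0\}$, $u^{\pm}$ is the restriction of $u$ to $\Omega^{\pm}\cup T$. Subscripts denote positive and negative parts: $h_{+}=\max\{h,0\}$, $h_{-}=\max\{-h,0\}$ (so $f^{+}_{+}$ is the positive part of $f^{+}$, etc.). $\chi_E$ is the characteristic function of $E$. $USC(E)$, $LSC(E)$ are the real-valued upper/lower semicontinuous functions on $E$. The convex envelope is $$\Gamma_u(x)=\sup\{\ell(x):\ \ell\text{ affine},\ \ell\le -u_{-}\chi_{B_R}\text{ in }B_{2R}\}.$$ Extremal operators. For a symmetric matrix $M$, $\mathcal{M}^{-}(M;\tfrac{\lambda}{n},\Lambda)=\inf\{\operatorname{Tr}(AM):\ A\text{ symmetric},\ \tfrac{\lambda}{n}I\le A\le\Lambda I\}$. Let $\mathcal{O}_{\lambda,\Lambda,\mu}=\{\gamma=(\gamma',\gamma_n)\in\mathbb{R}^{n-1}\times\mathbb{R}:\ \lambda\le\gamma_n\le\Lambda,\ |\gamma'|\le\mu\}$ and, for $\xi^{\pm}\in\mathbb{R}^n$, $$\mathcal{T}^{-}(\xi^{+},\xi^{-};\lambda,\Lambda,\mu)=\inf_{\gamma^{+},\gamma^{-}\in\mathcal{O}_{\lambda,\Lambda,\mu}}[\gamma^{+}\cdot\xi^{+}-\gamma^{-}\cdot\xi^{-}].$$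 Class $\overline{S}$. A function $\varphi\in C(\Omega)$ is admissible if $\varphi^{\pm}\in C^2(\Omega^{\pm})\cap C^{1,1}(\Omega^{\pm}\cup T)$ (each restriction is $C^2$ in the open phase and $C^{1,1}$ up to the interface). A continuous $\varphi$ touches $u$ from below at $x_0\in\Omega$ if $\varphi(x_0)=u(x_0)$ and $\varphi\le u$ in a neighborhood of $x_0$. One writes $u\in\overline{S}(\lambda,\Lambda,\mu,\theta;f^{+},f^{-},g)$ in $\Omega$ if $u\in LSC(\Omega)$ and whenever an admissible $\varphi$ touches $u$ from below at $x_0\in\Omega$: if $x_0\in\Omega^{\pm}$ then $\mathcal{M}^{-}(D^2\varphi(x_0);\tfrac{\lambda}{n},\Lambda)\le f^{\pm}(x_0)$; if $x_0\in T$ then $\mathcal{T}^{-}(\nabla\varphi^{+}(x_0),\theta\nabla\varphi^{-}(x_0);\lambda,\Lambda,\mu)\le g(x_0)$. *)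

theory Defs
  imports "HOL-Analysis.Analysis" "HOL-Probability.Essential_Supremum"
begin

text \<open>
  Points of \<open>n\<close>-space are vectors of type \<^typ>\<open>real ^ 'n\<close> with \<open>n = CARD('n) \<ge> 1\<close>.  A fixed
  coordinate \<open>k :: 'n\<close> plays the role of the last coordinate \<open>x\<^sub>n\<close>; the remaining coordinates
  form \<open>x'\<close> (no coordinates at all when \<open>n = 1\<close>).
\<close>

definition upper_part :: "'n::finite \<Rightarrow> (real ^ 'n) set \<Rightarrow> (real ^ 'n) set" where
  "upper_part k \<Omega> = \<Omega> \<inter> {x. x $ k > 0}"

definition lower_part :: "'n::finite \<Rightarrow> (real ^ 'n) set \<Rightarrow> (real ^ 'n) set" where
  "lower_part k \<Omega> = \<Omega> \<inter> {x. x $ k < 0}"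

definition interface :: "'n::finite \<Rightarrow> (real ^ 'n) set \<Rightarrow> (real ^ 'n) set" where
  "interface k \<Omega> = \<Omega> \<inter> {x. x $ k = 0}"

text \<open>The vector \<open>(x', 0)\<close>, whose norm is that of \<open>x'\<close>.\<close>

definition tangential :: "'n::finite \<Rightarrow> real ^ 'n \<Rightarrow> real ^ 'n" where
  "tangential k x = (\<chi> i. if i = k then 0 else x $ i)"

definition pos_part :: "real \<Rightarrow> real" where
  "pos_part h = max h 0"

definition neg_part :: "real \<Rightarrow> real" where
  "neg_part h = max (- h) 0"

definition lsc_on :: "'a::topological_space set \<Rightarrow> ('a \<Rightarrow> real) \<Rightarrow> bool" where
  "lsc_on E u \<longleftrightarrow> (\<forall>x\<in>E. \<forall>c < u x. \<forall>\<^sub>F y in at x within E. c < u y)"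

text \<open>
  Gradient relative to \<open>S\<close>.  At a point of the flat boundary of a half ball this is the one-sided
  gradient; it is uniquely determined there because the directions pointing into a half space span
  the whole space.
\<close>

definition grad_within :: "(real ^ 'n::finite) set \<Rightarrow> (real ^ 'n \<Rightarrow> real) \<Rightarrow> real ^ 'n \<Rightarrow> real ^ 'n" where
  "grad_within S \<phi> x = (\<chi> i. frechet_derivative \<phi> (at x within S) (axis i 1))"

definition hessian :: "(real ^ 'n::finite \<Rightarrow> real) \<Rightarrow> real ^ 'n \<Rightarrow> real ^ 'n ^ 'n" where
  "hessian \<phi> x = jacobian (grad_within UNIV \<phi>) (at x)"

text \<open>To be used for open sets \<open>U\<close>.\<close>

definition C2_on :: "(real ^ 'n::finite) set \<Rightarrow> (real ^ 'n \<Rightarrow> real) \<Rightarrow> bool" where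
  "C2_on U \<phi> \<longleftrightarrow>
     (\<forall>x\<in>U. \<phi> differentiable (at x)) \<and>
     (\<forall>x\<in>U. grad_within UNIV \<phi> differentiable (at x)) \<and>
     continuous_on U (hessian \<phi>)"

text \<open>
  \<open>C\<^sup>1\<^sup>,\<^sup>1\<close> on \<open>S\<close>, in the local sense: every point of \<open>S\<close> (in particular every point of the flat
  boundary part contained in \<open>S\<close>) has a relative neighbourhood on which the gradient is Lipschitz.
\<close>

definition C11_on :: "(real ^ 'n::finite) set \<Rightarrow> (real ^ 'n \<Rightarrow> real) \<Rightarrow> bool" where
  "C11_on S \<phi> \<longleftrightarrow>
     (\<forall>x\<in>S. \<phi> differentiable (at x within S)) \<and>
     (\<forall>x\<in>S. \<exists>r>0. \<exists>L. L-lipschitz_on (S \<inter> ball x r) (grad_within S \<phi>))"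

definition admissible :: "'n::finite \<Rightarrow> (real ^ 'n) set \<Rightarrow> (real ^ 'n \<Rightarrow> real) \<Rightarrow> bool" where
  "admissible k \<Omega> \<phi> \<longleftrightarrow>
     continuous_on \<Omega> \<phi> \<and>
     C2_on (upper_part k \<Omega>) \<phi> \<and> C11_on (upper_part k \<Omega> \<union> interface k \<Omega>) \<phi> \<and>
     C2_on (lower_part k \<Omega>) \<phi> \<and> C11_on (lower_part k \<Omega> \<union> interface k \<Omega>) \<phi>"

definition touches_below ::
    "(real ^ 'n::finite \<Rightarrow> real) \<Rightarrow> (real ^ 'n \<Rightarrow> real) \<Rightarrow> real ^ 'n \<Rightarrow> bool" where
  "touches_below \<phi> u x0 \<longleftrightarrow> \<phi> x0 = u x0 \<and> (\<forall>\<^sub>F y in nhds x0. \<phi> y \<le> u y)"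

definition loewner_le :: "real ^ 'n ^ 'n::finite \<Rightarrow> real ^ 'n ^ 'n \<Rightarrow> bool" where
  "loewner_le A B \<longleftrightarrow> (\<forall>x. x \<bullet> (A *v x) \<le> x \<bullet> (B *v x))"

definition pucci_min :: "real ^ 'n ^ 'n::finite \<Rightarrow> real \<Rightarrow> real \<Rightarrow> real" where
  "pucci_min M a b =
     Inf {trace (A ** M) | A. transpose A = A \<and> loewner_le (mat a) A \<and> loewner_le A (mat b)}"

definition oblique_set :: "'n::finite \<Rightarrow> real \<Rightarrow> real \<Rightarrow> real \<Rightarrow> (real ^ 'n) set" where
  "oblique_set k lam Lam mu =
     {\<gamma>. lam \<le> \<gamma> $ k \<and> \<gamma> $ k \<le> Lam \<and> norm (tangential k \<gamma>) \<le> mu}"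

definition transmission_min ::
    "'n::finite \<Rightarrow> real ^ 'n \<Rightarrow> real ^ 'n \<Rightarrow> real \<Rightarrow> real \<Rightarrow> real \<Rightarrow> real" where
  "transmission_min k \<xi>p \<xi>m lam Lam mu =
     Inf {\<gamma>p \<bullet> \<xi>p - \<gamma>m \<bullet> \<xi>m | \<gamma>p \<gamma>m.
            \<gamma>p \<in> oblique_set k lam Lam mu \<and> \<gamma>m \<in> oblique_set k lam Lam mu}"

text \<open>
  The class \<open>S\<close> with an overline, for an open set \<open>\<Omega>\<close>.  The functions \<open>fp\<close>, \<open>fm\<close>, \<open>g\<close> are the data
  \<open>f\<^sup>+\<close>, \<open>f\<^sup>-\<close>, \<open>g\<close>; only their values on the respective parts of \<open>\<Omega>\<close> matter.
\<close>

definition S_upper ::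
    "'n::finite \<Rightarrow> real \<Rightarrow> real \<Rightarrow> real \<Rightarrow> real \<Rightarrow>
     (real ^ 'n \<Rightarrow> real) \<Rightarrow> (real ^ 'n \<Rightarrow> real) \<Rightarrow> (real ^ 'n \<Rightarrow> real) \<Rightarrow>
     (real ^ 'n) set \<Rightarrow> (real ^ 'n \<Rightarrow> real) set" where
  "S_upper k lam Lam mu \<theta> fp fm g \<Omega> =
     {u. lsc_on \<Omega> u \<and>
         (\<forall>\<phi> x0. admissible k \<Omega> \<phi> \<and> x0 \<in> \<Omega> \<and> touches_below \<phi> u x0 \<longrightarrow>
            (x0 \<in> upper_part k \<Omega> \<longrightarrow>
               pucci_min (hessian \<phi> x0) (lam / real CARD('n)) Lam \<le> fp x0) \<and>
            (x0 \<in> lower_part k \<Omega> \<longrightarrow>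
               pucci_min (hessian \<phi> x0) (lam / real CARD('n)) Lam \<le> fm x0) \<and>
            (x0 \<in> interface k \<Omega> \<longrightarrow>
               transmission_min k
                 (grad_within (upper_part k \<Omega> \<union> interface k \<Omega>) \<phi> x0)
                 (\<theta> *\<^sub>R grad_within (lower_part k \<Omega> \<union> interface k \<Omega>) \<phi> x0)
                 lam Lam mu \<le> g x0))}"

text \<open>The convex envelope; it is meant to be evaluated in the ball of radius \<open>2 * R\<close> only.\<close>

definition convex_envelope ::
    "real \<Rightarrow> (real ^ 'n::finite \<Rightarrow> real) \<Rightarrow> real ^ 'n \<Rightarrow> real" where
  "convex_envelope R u x =
     Sup {a \<bullet> x + b | a b.
            \<forall>y\<in>ball 0 (2 * R). a \<bullet> y + b \<le> - neg_part (u y) * indicator (ball 0 R) y}"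

text \<open>
  Norms take values in \<^typ>\<open>ennreal\<close>, since the data are only assumed continuous on sets that are
  not closed and their norms may be infinite.
\<close>

definition Lp_norm :: "nat \<Rightarrow> (real ^ 'n::finite) set \<Rightarrow> (real ^ 'n \<Rightarrow> real) \<Rightarrow> ennreal" where
  "Lp_norm p E h =
     (let I = (\<integral>\<^sup>+x\<in>E. ennreal (\<bar>h x\<bar> ^ p) \<partial>lborel)
      in if I = \<infinity> then \<infinity> else ennreal (root p (enn2real I)))"

text \<open>
  The \<open>(n - 1)\<close>-dimensional Lebesgue measure on the hyperplane \<open>x\<^sub>k = 0\<close>, as a Borel measure on the
  whole space; for \<open>n = 1\<close> it is the unit mass at the origin.
\<close>

definition hyperplane_measure :: "'n::finite \<Rightarrow> (real ^ 'n) measure" where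
  "hyperplane_measure k =
     distr (Pi\<^sub>M (UNIV - {k}) (\<lambda>_. lborel)) borel (\<lambda>y. \<chi> i. if i = k then 0 else y i)"

definition Linf_norm :: "(real ^ 'n::finite) measure \<Rightarrow> (real ^ 'n) set \<Rightarrow> (real ^ 'n \<Rightarrow> real) \<Rightarrow> ennreal" where
  "Linf_norm M E h = esssup (restrict_space M E) (\<lambda>x. ennreal \<bar>h x\<bar>)"

end

theory Submission
  imports Defs
begin

text \<open>
  Slide the wedge \<open>q y = p \<bullet> y + K \<bar>y\<^sub>k\<bar>\<close>, with \<open>K\<close> comparable to \<open>m / R\<close>, where \<open>m\<close> is the
  excess of \<open>sup u\<^sub>-\<close> over its boundary values, and \<open>\<bar>p\<bar> \<le> \<delta> K\<close>, up from below until it touches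
  \<open>- u\<^sub>-\<close>.  The contact point is interior, and since \<open>q\<close> is convex it belongs to \<open>{u = \<Gamma>\<^sub>u}\<close>.  If it
  lies on the interface, the wedge is an admissible test function whose normal derivatives jump by
  about \<open>2 K\<close>, with a positive slope above and a negative one below; for small \<open>\<delta>\<close> the transmission
  condition then gives \<open>\<lambda> K / 2 \<le> g\<close>, uniformly in \<open>\<theta>\<close>.  Otherwise no contact happens on the
  interface, and a ball of radius \<open>\<delta> K\<close> is covered by translates of the sets of slopes of planes
  supporting \<open>u\<close> at contact points of the two open phases.  At nearby contact points such slopes
  differ by at most a constant times \<open>r sup f\<^sub>+\<close>, so that the volume of these sets is controlled by the
  integral of \<open>(f\<^sub>+)\<^sup>n\<close> over the contact set, without any regularity of \<open>\<Gamma>\<^sub>u\<close>.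
\<close>

section \<open>Piecewise quadratic test functions\<close>

text \<open>Touching by planes alone is of no use on the interface: for a plane of slope p the
  infimum defining \<open>transmission_min\<close> can be negative, and then nothing follows about
  \<open>g\<close>. The kink adds K times a normal component of size at least \<lambda> from the
  side above and \<theta> times such a term from below, both with a favourable sign. It costs
  nothing in the phases, where the wedge is a plane of slope p + K e or p - K e with e =
  \<open>axis k 1\<close>, since volume is invariant under translation.

  The classical proof shows that the envelope is C^{1,1} on the contact set and applies the area
  formula to its gradient. Here only planes supporting \<open>u\<close> within one phase are
  compared, and only inside cubes so small that f is nearly constant. In a cube of side s the slopes
  lie in a ball of radius a constant times s F, where F bounds the positive part of f nearby; its
  volume is a constant times F^n s^n, and the sum over the cubes is an integral. As the cubes may
  shrink towards the boundary of the phase, f may be unbounded there.\<close>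

definition quadratic :: "real \<Rightarrow> real ^ 'n \<Rightarrow> real ^ 'n ^ 'n \<Rightarrow> real ^ 'n::finite \<Rightarrow> real" where
  "quadratic c a B y = c + a \<bullet> y + y \<bullet> (B *v y) / 2"

lemma has_derivative_quadratic:
  fixes B :: "real ^ 'n ^ 'n::finite"
  assumes "transpose B = B"
  shows "(quadratic c a B has_derivative (\<lambda>h. (a + B *v y) \<bullet> h)) (at y within S)"
proof -
  have sym: "h \<bullet> (B *v y) = y \<bullet> (B *v h)" for h
    by (metis assms dot_lmul_matrix inner_commute transpose_matrix_vector)
  have lin: "bounded_linear ((*v) B)"
    by simp
  have "((\<lambda>y. c + a \<bullet> y + y \<bullet> (B *v y) / 2) has_derivative
      (\<lambda>h. a \<bullet> h + (y \<bullet> (B *v h) + h \<bullet> (B *v y)) / 2)) (at y within S)"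
    by (auto intro!: derivative_eq_intros bounded_linear_imp_has_derivative[OF lin])
  moreover have "a \<bullet> h + (y \<bullet> (B *v h) + h \<bullet> (B *v y)) / 2 = (a + B *v y) \<bullet> h" for h
    using sym[of h] by (simp add: inner_add_left) (simp add: inner_commute)
  ultimately show ?thesis
    unfolding quadratic_def by (auto elim: has_derivative_eq_rhs)
qed

lemma continuous_on_quadratic: "continuous_on S (quadratic c a B)"
  unfolding quadratic_def
  by (intro continuous_intros matrix_vector_mult_linear_continuous_on) simp

text \<open>The hypothesis of \<open>frechet_derivative_unique_within\<close>, under which a
  derivative relative to \<open>S\<close> determines the gradient. One sign of \<open>d\<close> per
  axis is enough, so that flat boundary points of a half ball are covered.\<close>

definition axis_approachable :: "(real ^ 'n::finite) set \<Rightarrow> bool" where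
  "axis_approachable S \<longleftrightarrow>
     (\<forall>x\<in>S. \<forall>i. \<forall>e>0. \<exists>d. 0 < \<bar>d\<bar> \<and> \<bar>d\<bar> < e \<and> x + d *\<^sub>R axis i 1 \<in> S)"

lemma grad_within_unique:
  assumes "axis_approachable S" "x \<in> S"
    and "(\<phi> has_derivative (\<lambda>h. v \<bullet> h)) (at x within S)"
  shows "grad_within S \<phi> x = v"
proof -
  have "(\<phi> has_derivative frechet_derivative \<phi> (at x within S)) (at x within S)"
    using assms(3) differentiableI frechet_derivative_works by blast
  then have "frechet_derivative \<phi> (at x within S) = (\<lambda>h. v \<bullet> h)"
    using assms unfolding axis_approachable_def
    by (intro frechet_derivative_unique_within[of \<phi> _ x S]) (auto simp: Basis_vec_def)
  then show ?thesis
    by (simp add: grad_within_def vec_eq_iff inner_axis)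
qed

lemma open_axis_approachable:
  assumes "open S"
  shows "axis_approachable S"
  unfolding axis_approachable_def
proof (intro ballI allI impI)
  fix x i and e :: real
  assume "x \<in> S" "e > 0"
  then obtain r where "r > 0" "ball x r \<subseteq> S"
    using assms openE by blast
  then show "\<exists>d. 0 < \<bar>d\<bar> \<and> \<bar>d\<bar> < e \<and> x + d *\<^sub>R axis i 1 \<in> S"
    using \<open>e > 0\<close> by (intro exI[of _ "min e r / 2"]) (auto simp: dist_norm norm_axis_1)
qed

text \<open>The factor \<open>s\<close> treats both closed phases at once. The step \<open>d\<close>
  gets the sign of \<open>s\<close>, so that moving along axis \<open>k\<close> leads into the
  phase, while moving along the other axes leaves coordinate \<open>k\<close> unchanged.\<close>

lemma half_axis_approachable:
  assumes "open \<Omega>" "s \<noteq> 0"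
  shows "axis_approachable (\<Omega> \<inter> {x. 0 \<le> s * x $ k})"
  unfolding axis_approachable_def
proof (intro ballI allI impI)
  fix x i and e :: real
  assume x: "x \<in> \<Omega> \<inter> {x. 0 \<le> s * x $ k}" and "e > 0"
  then obtain r where r: "r > 0" "ball x r \<subseteq> \<Omega>"
    using assms openE by blast
  define d where "d = sgn s * (min e r / 2)"
  have d: "\<bar>d\<bar> = min e r / 2" "0 \<le> s * d"
    using assms r \<open>e > 0\<close> abs_sgn[of s]
    by (auto simp: d_def abs_mult abs_sgn_eq mult.assoc[symmetric])
  have "x + d *\<^sub>R axis i 1 \<in> ball x r"
    using d r \<open>e > 0\<close> by (auto simp: dist_norm norm_axis_1)
  then show "\<exists>d. 0 < \<bar>d\<bar> \<and> \<bar>d\<bar> < e \<and> x + d *\<^sub>R axis i 1 \<in> \<Omega> \<inter> {x. 0 \<le> s * x $ k}"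
  proof (intro exI[of _ d] conjI)
    have "s * (x + d *\<^sub>R axis i 1) $ k = s * x $ k + s * d * axis i 1 $ k"
      by (simp add: distrib_left)
    also have "\<dots> \<ge> 0"
      using d(2) x by (simp add: axis_def)
    finally show "x + d *\<^sub>R axis i 1 \<in> \<Omega> \<inter> {x. 0 \<le> s * x $ k}"
      using \<open>x + d *\<^sub>R axis i 1 \<in> ball x r\<close> r by blast
  qed (use d r \<open>e > 0\<close> in linarith)+
qed

lemma eq_quadratic_grad_within:
  fixes B :: "real ^ 'n ^ 'n::finite"
  assumes "axis_approachable S" "transpose B = B" "x \<in> S" "\<And>y. y \<in> S \<Longrightarrow> \<phi> y = quadratic c a B y"
  shows "(\<phi> has_derivative (\<lambda>h. (a + B *v x) \<bullet> h)) (at x within S)"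
    and "grad_within S \<phi> x = a + B *v x"
proof -
  show 1: "(\<phi> has_derivative (\<lambda>h. (a + B *v x) \<bullet> h)) (at x within S)"
    using has_derivative_transform[OF \<open>x \<in> S\<close> _ has_derivative_quadratic[OF assms(2)]] assms(4)
    by blast
  show "grad_within S \<phi> x = a + B *v x"
    using grad_within_unique assms 1 by blast
qed

lemma C11_on_eq_quadratic:
  fixes B :: "real ^ 'n ^ 'n::finite"
  assumes "axis_approachable S" "transpose B = B" "\<And>y. y \<in> S \<Longrightarrow> \<phi> y = quadratic c a B y"
  shows "C11_on S \<phi>"
proof -
  have diff: "\<phi> differentiable (at x within S)" if "x \<in> S" for x
    using eq_quadratic_grad_within(1)[OF assms(1,2) that assms(3)] differentiableI by blast
  obtain L where L: "L > 0" "\<And>x. norm (B *v x) \<le> L * norm x"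
    using linear_bounded_pos[of "(*v) B"] by auto
  have "L-lipschitz_on S (grad_within S \<phi>)"
  proof (rule lipschitz_onI)
    fix x y assume "x \<in> S" "y \<in> S"
    then show "dist (grad_within S \<phi> x) (grad_within S \<phi> y) \<le> L * dist x y"
      using L(2)[of "x - y"] eq_quadratic_grad_within(2)[OF assms(1,2) _ assms(3)]
      by (simp add: dist_norm matrix_vector_mult_diff_distrib)
  qed (use L in simp)
  then have "L-lipschitz_on (S \<inter> ball x 1) (grad_within S \<phi>)" for x
    by (rule lipschitz_on_subset) simp
  then show ?thesis
    unfolding C11_on_def using diff zero_less_one by blast
qed

lemma eq_quadratic_open:
  fixes B :: "real ^ 'n ^ 'n::finite"
  assumes "open U" "transpose B = B" "\<And>y. y \<in> U \<Longrightarrow> \<phi> y = quadratic c a B y"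
  shows "C2_on U \<phi>" and "x \<in> U \<Longrightarrow> hessian \<phi> x = B"
proof -
  have der: "(\<phi> has_derivative (\<lambda>h. (a + B *v x) \<bullet> h)) (at x)" if "x \<in> U" for x
    using has_derivative_transform_within_open[OF has_derivative_quadratic[OF assms(2)] \<open>open U\<close> that]
      assms(3) by metis
  have grad: "grad_within UNIV \<phi> x = a + B *v x" if "x \<in> U" for x
    by (rule grad_within_unique) (use der[OF that] open_axis_approachable in auto)
  have der2: "(grad_within UNIV \<phi> has_derivative (*v) B) (at x)" if "x \<in> U" for x
  proof -
    have "((\<lambda>x. a + B *v x) has_derivative (\<lambda>h. 0 + B *v h)) (at x)"
      by (intro has_derivative_add has_derivative_const bounded_linear_imp_has_derivative) simp
    then show ?thesis
      using has_derivative_transform_within_open[of "\<lambda>x. a + B *v x" "(*v) B" x UNIV U] \<open>open U\<close> that grad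
      by simp
  qed
  show hess: "hessian \<phi> x = B" if "x \<in> U" for x
    unfolding hessian_def jacobian_def frechet_derivative_at[OF der2[OF that], symmetric] by simp
  show "C2_on U \<phi>"
    unfolding C2_on_def
  proof (intro conjI ballI)
    show "continuous_on U (hessian \<phi>)"
      using continuous_on_const by (rule continuous_on_eq) (simp add: hess)
  qed (auto intro: differentiableI der der2)
qed

lemma upper_interface_eq: "upper_part k \<Omega> \<union> interface k \<Omega> = \<Omega> \<inter> {x. 0 \<le> 1 * x $ k}"
  and lower_interface_eq: "lower_part k \<Omega> \<union> interface k \<Omega> = \<Omega> \<inter> {x. 0 \<le> -1 * x $ k}"
  unfolding upper_part_def lower_part_def interface_def by auto

lemma open_upper_part: "open \<Omega> \<Longrightarrow> open (upper_part k \<Omega>)"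
  and open_lower_part: "open \<Omega> \<Longrightarrow> open (lower_part k \<Omega>)"
  unfolding upper_part_def lower_part_def
  by (auto intro!: open_Int open_Collect_less continuous_intros)

text \<open>Both formulas are required on closed half spaces, hence agree on the hyperplane, and
  continuity follows by pasting. Gradients and Hessians may jump there, since admissibility looks at
  each side separately.\<close>

lemma admissible_piecewise_quadratic:
  fixes Bp Bm :: "real ^ 'n ^ 'n::finite"
  assumes "open \<Omega>" "transpose Bp = Bp" "transpose Bm = Bm"
    and up: "\<And>y. 0 \<le> y $ k \<Longrightarrow> \<phi> y = quadratic cp ap Bp y"
    and lo: "\<And>y. y $ k \<le> 0 \<Longrightarrow> \<phi> y = quadratic cm am Bm y"
  shows "admissible k \<Omega> \<phi>"
proof -
  have "continuous_on ({y. 0 \<le> y $ k} \<union> {y. y $ k \<le> 0}) \<phi>"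
  proof (rule continuous_on_closed_Un)
    show "continuous_on {y. 0 \<le> y $ k} \<phi>"
      using continuous_on_quadratic by (rule continuous_on_eq) (simp add: up)
    show "continuous_on {y. y $ k \<le> 0} \<phi>"
      using continuous_on_quadratic by (rule continuous_on_eq) (simp add: lo)
  qed (auto intro!: closed_Collect_le continuous_intros)
  moreover have "{y. 0 \<le> y $ k} \<union> {y :: real ^ 'n. y $ k \<le> 0} = UNIV"
    by auto
  ultimately have "continuous_on \<Omega> \<phi>"
    using continuous_on_subset by fastforce
  moreover have "C2_on (upper_part k \<Omega>) \<phi>"
    by (rule eq_quadratic_open(1)[OF open_upper_part assms(2)]) (auto simp: assms upper_part_def up)
  moreover have "C2_on (lower_part k \<Omega>) \<phi>"
    by (rule eq_quadratic_open(1)[OF open_lower_part assms(3)]) (auto simp: assms lower_part_def lo)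
  moreover have "C11_on (upper_part k \<Omega> \<union> interface k \<Omega>) \<phi>"
    unfolding upper_interface_eq
    by (rule C11_on_eq_quadratic[OF half_axis_approachable assms(2)]) (auto simp: assms(1) up)
  moreover have "C11_on (lower_part k \<Omega> \<union> interface k \<Omega>) \<phi>"
    unfolding lower_interface_eq
    by (rule C11_on_eq_quadratic[OF half_axis_approachable assms(3)]) (auto simp: assms(1) lo)
  ultimately show ?thesis
    unfolding admissible_def by blast
qed

section \<open>Testing the class with quadratics and wedges\<close>

lemma S_upper_upper_part:
  fixes B :: "real ^ 'n ^ 'n::finite"
  assumes "u \<in> S_upper k lam Lam mu \<theta> fp fm g \<Omega>" "open \<Omega>" "x \<in> upper_part k \<Omega>"
    and "transpose B = B" "touches_below (quadratic c a B) u x"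
  shows "pucci_min B (lam / real CARD('n)) Lam \<le> fp x"
proof -
  have "admissible k \<Omega> (quadratic c a B)"
    by (rule admissible_piecewise_quadratic) (use assms in auto)
  then have "pucci_min (hessian (quadratic c a B) x) (lam / real CARD('n)) Lam \<le> fp x"
    using assms unfolding S_upper_def upper_part_def by blast
  then show ?thesis
    by (simp add: eq_quadratic_open(2)[OF open_UNIV assms(4)])
qed

lemma S_upper_lower_part:
  fixes B :: "real ^ 'n ^ 'n::finite"
  assumes "u \<in> S_upper k lam Lam mu \<theta> fp fm g \<Omega>" "open \<Omega>" "x \<in> lower_part k \<Omega>"
    and "transpose B = B" "touches_below (quadratic c a B) u x"
  shows "pucci_min B (lam / real CARD('n)) Lam \<le> fm x"
proof -
  have "admissible k \<Omega> (quadratic c a B)"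
    by (rule admissible_piecewise_quadratic) (use assms in auto)
  then have "pucci_min (hessian (quadratic c a B) x) (lam / real CARD('n)) Lam \<le> fm x"
    using assms unfolding S_upper_def lower_part_def by blast
  then show ?thesis
    by (simp add: eq_quadratic_open(2)[OF open_UNIV assms(4)])
qed

lemma S_upper_interface:
  assumes u: "u \<in> S_upper k lam Lam mu \<theta> fp fm g \<Omega>" and "open \<Omega>" and x: "x \<in> interface k \<Omega>"
    and touch: "touches_below (\<lambda>y. c + p \<bullet> y + K * \<bar>y $ k\<bar>) u x"
  shows "transmission_min k (p + K *\<^sub>R axis k 1) (\<theta> *\<^sub>R (p - K *\<^sub>R axis k 1)) lam Lam mu \<le> g x"
proof -
  let ?\<phi> = "\<lambda>y. c + p \<bullet> y + K * \<bar>y $ k\<bar>"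
  have up: "?\<phi> y = quadratic c (p + K *\<^sub>R axis k 1) 0 y" if "0 \<le> y $ k" for y
    using that by (simp add: quadratic_def inner_add_left inner_axis' )
  have lo: "?\<phi> y = quadratic c (p - K *\<^sub>R axis k 1) 0 y" if "y $ k \<le> 0" for y
    using that by (simp add: quadratic_def inner_diff_left inner_axis')
  have tr: "transpose (0 :: real ^ 'a ^ 'a) = 0"
    by (simp add: transpose_def vec_eq_iff)
  have "admissible k \<Omega> ?\<phi>"
    by (rule admissible_piecewise_quadratic[OF \<open>open \<Omega>\<close> tr tr up lo])
  then have "transmission_min k
                 (grad_within (upper_part k \<Omega> \<union> interface k \<Omega>) ?\<phi> x)
                 (\<theta> *\<^sub>R grad_within (lower_part k \<Omega> \<union> interface k \<Omega>) ?\<phi> x)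
                 lam Lam mu \<le> g x"
    using assms unfolding S_upper_def interface_def by blast
  moreover have "grad_within (upper_part k \<Omega> \<union> interface k \<Omega>) ?\<phi> x = p + K *\<^sub>R axis k 1 + 0 *v x"
    unfolding upper_interface_eq
    by (rule eq_quadratic_grad_within(2)[OF half_axis_approachable tr _ up])
      (use x \<open>open \<Omega>\<close> in \<open>auto simp: interface_def\<close>)
  moreover have "grad_within (lower_part k \<Omega> \<union> interface k \<Omega>) ?\<phi> x = p - K *\<^sub>R axis k 1 + 0 *v x"
    unfolding lower_interface_eq
    by (rule eq_quadratic_grad_within(2)[OF half_axis_approachable tr _ lo])
      (use x \<open>open \<Omega>\<close> in \<open>auto simp: interface_def\<close>)
  ultimately show ?thesis by simp
qed

section \<open>Lower semicontinuous functions\<close>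

lemma lsc_on_attains_inf:
  fixes u :: "'a::topological_space \<Rightarrow> real"
  assumes "compact S" "S \<noteq> {}" "lsc_on S u"
  shows "\<exists>x\<in>S. \<forall>y\<in>S. u x \<le> u y"
proof (rule ccontr)
  assume "\<not> ?thesis"
  then have "\<forall>x\<in>S. \<exists>y\<in>S. u y < u x"
    by (meson not_le)
  \<comment> \<open>Each x has a strictly lower point \<open>t x\<close>, and by semicontinuity a
    neighbourhood on which u stays above \<open>u (t x)\<close>. Among finitely many such
    neighbourhoods covering S, the lowest of the points \<open>t x\<close> has nowhere to
    lie.\<close>
  then obtain t where t: "\<And>x. x \<in> S \<Longrightarrow> t x \<in> S \<and> u (t x) < u x"
    by metis
  have "\<exists>V. open V \<and> x \<in> V \<and> (\<forall>y\<in>V \<inter> S. u (t x) < u y)" if x: "x \<in> S" for x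
  proof -
    have "\<forall>\<^sub>F y in at x within S. u (t x) < u y"
      using assms(3) t[OF x] x unfolding lsc_on_def by blast
    then obtain V where "open V" "x \<in> V" "\<forall>y\<in>V. y \<noteq> x \<longrightarrow> y \<in> S \<longrightarrow> u (t x) < u y"
      unfolding eventually_at_topological by blast
    then show ?thesis
      using t[OF x] by (intro exI[of _ V]) (metis IntD1 IntD2)
  qed
  then obtain V where V: "\<And>x. x \<in> S \<Longrightarrow> open (V x) \<and> x \<in> V x \<and> (\<forall>y\<in>V x \<inter> S. u (t x) < u y)"
    by metis
  obtain F where F: "F \<subseteq> S" "finite F" "S \<subseteq> (\<Union>x\<in>F. V x)"
    by (rule compactE_image[OF \<open>compact S\<close>, of S V]) (use V in blast)+
  then have "F \<noteq> {}"
    using \<open>S \<noteq> {}\<close> by auto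
  define z where "z = arg_min_on (u \<circ> t) F"
  have z: "z \<in> F" "\<And>x. x \<in> F \<Longrightarrow> u (t z) \<le> u (t x)"
    using arg_min_if_finite[OF F(2) \<open>F \<noteq> {}\<close>, of "u \<circ> t"] by (auto simp: z_def not_less)
  then have "t z \<in> S"
    using t F by blast
  then obtain x where "x \<in> F" "t z \<in> V x"
    using F by blast
  then have "u (t x) < u (t z)"
    using V[of x] \<open>t z \<in> S\<close> F(1) by (metis IntI subsetD)
  then show False
    using z(2)[OF \<open>x \<in> F\<close>] by linarith
qed

lemma lsc_on_subset: "lsc_on S u \<Longrightarrow> T \<subseteq> S \<Longrightarrow> lsc_on T u"
  unfolding lsc_on_def using filter_leD[OF at_le] by (metis subsetD)

lemma lsc_on_add_continuous:
  assumes "lsc_on S u" "continuous_on S h"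
  shows "lsc_on S (\<lambda>x. u x + h x)"
  unfolding lsc_on_def
proof (intro ballI allI impI)
  fix x c assume x: "x \<in> S" and c: "c < u x + h x"
  define e where "e = (u x + h x - c) / 2"
  have e: "e > 0"
    using c by (simp add: e_def)
  have "\<forall>\<^sub>F y in at x within S. u x - e < u y"
    using assms(1) x e unfolding lsc_on_def by simp
  moreover have "\<forall>\<^sub>F y in at x within S. h x - e < h y"
    using assms(2) x e unfolding continuous_on_def by (auto intro!: order_tendstoD(1))
  ultimately show "\<forall>\<^sub>F y in at x within S. c < u y + h y"
    by eventually_elim (use e_def in \<open>auto simp: field_simps\<close>)
qed

section \<open>Slopes of supporting planes\<close>

text \<open>The interior condition alone, tested on quadratics. The two phases become instances of
  it, so that the slope estimate is proved once.\<close>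

definition pucci_supersolution ::
    "real \<Rightarrow> real \<Rightarrow> (real ^ 'n::finite \<Rightarrow> real) \<Rightarrow> (real ^ 'n) set \<Rightarrow> (real ^ 'n \<Rightarrow> real) \<Rightarrow> bool" where
  "pucci_supersolution a b f U u \<longleftrightarrow>
     (\<forall>x\<in>U. \<forall>c v B. transpose B = B \<longrightarrow> touches_below (quadratic c v B) u x \<longrightarrow>
        pucci_min B a b \<le> f x)"

text \<open>The matrix \<alpha> e e^T - \<beta> I. For a unit vector e it has eigenvalue \<alpha> -
  \<beta> along e and -\<beta> across.\<close>

definition rank_one_shift :: "real \<Rightarrow> real ^ 'n \<Rightarrow> real \<Rightarrow> real ^ 'n ^ 'n::finite" where
  "rank_one_shift \<alpha> e \<beta> = (\<chi> i j. \<alpha> * (e $ i * e $ j) - (if i = j then \<beta> else 0))"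

lemma transpose_rank_one_shift: "transpose (rank_one_shift \<alpha> e \<beta>) = rank_one_shift \<alpha> e \<beta>"
  by (simp add: transpose_def rank_one_shift_def vec_eq_iff mult.commute)

lemma rank_one_shift_mult_vec: "rank_one_shift \<alpha> e \<beta> *v z = (\<alpha> * (e \<bullet> z)) *\<^sub>R e - \<beta> *\<^sub>R z"
proof -
  have "(\<Sum>j\<in>UNIV. (\<alpha> * (e $ i * e $ j) - (if i = j then \<beta> else 0)) * z $ j)
      = \<alpha> * (\<Sum>j\<in>UNIV. e $ j * z $ j) * e $ i - \<beta> * z $ i" for i
  proof -
    have "(\<alpha> * (e $ i * e $ j) - (if i = j then \<beta> else 0)) * z $ j
        = \<alpha> * e $ i * (e $ j * z $ j) - (if i = j then \<beta> * z $ j else 0)" for j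
      by (simp add: left_diff_distrib)
    then show ?thesis
      by (simp add: sum_subtractf sum_distrib_left[symmetric])
  qed
  then show ?thesis
    by (simp add: rank_one_shift_def matrix_vector_mult_def vec_eq_iff inner_vec_def)
qed

lemma trace_mult_rank_one_shift:
  "trace (A ** rank_one_shift \<alpha> e \<beta>) = \<alpha> * (e \<bullet> (A *v e)) - \<beta> * trace A"
proof -
  have "(\<Sum>k\<in>UNIV. A $ i $ k * (\<alpha> * (e $ k * e $ i) - (if k = i then \<beta> else 0)))
      = \<alpha> * (e $ i * (\<Sum>k\<in>UNIV. A $ i $ k * e $ k)) - \<beta> * A $ i $ i" for i
  proof -
    have "A $ i $ k * (\<alpha> * (e $ k * e $ i) - (if k = i then \<beta> else 0))
        = \<alpha> * e $ i * (A $ i $ k * e $ k) - (if k = i then \<beta> * A $ i $ k else 0)" for k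
      by (simp add: right_diff_distrib)
    then show ?thesis
      by (simp add: sum_subtractf sum_distrib_left[symmetric])
  qed
  then show ?thesis
    by (simp add: trace_def matrix_matrix_mult_def rank_one_shift_def inner_vec_def
        matrix_vector_mult_def sum_subtractf sum_distrib_left)
qed

lemma mat_mult_vec: "mat a *v x = a *\<^sub>R (x :: real ^ 'n::finite)"
  by (simp add: mat_def matrix_vector_mult_def vec_eq_iff if_distrib if_distribR cong: if_cong)

lemma trace_le_of_loewner_le:
  fixes A :: "real ^ 'n ^ 'n::finite"
  assumes "loewner_le A (mat b)"
  shows "trace A \<le> real CARD('n) * b"
proof -
  have "A $ i $ i \<le> b" for i
  proof -
    have "axis i 1 \<bullet> (A *v axis i 1) \<le> axis i 1 \<bullet> (mat b *v axis i (1::real))"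
      using assms unfolding loewner_le_def by blast
    then show ?thesis
      by (simp add: mat_mult_vec inner_axis' matrix_vector_mul_component column_def)
        (simp add: inner_axis)
  qed
  then have "trace A \<le> (\<Sum>i\<in>(UNIV :: 'n set). b)"
    unfolding trace_def by (intro sum_mono)
  then show ?thesis by simp
qed

text \<open>The trace of A times this matrix is \<alpha> (e \<bullet> A e) - \<beta> tr A, where e
  \<bullet> A e is at least a and tr A is at most n b. The condition a \<le> b makes the set of
  competitors nonempty, without which \<open>Inf\<close> would be unspecified.\<close>

lemma pucci_min_rank_one_shift_ge:
  fixes e :: "real ^ 'n::finite"
  assumes "norm e = 1" "0 \<le> \<alpha>" "0 \<le> \<beta>" "a \<le> b"
  shows "\<alpha> * a - \<beta> * (real CARD('n) * b) \<le> pucci_min (rank_one_shift \<alpha> e \<beta>) a b"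
  unfolding pucci_min_def
proof (rule cInf_greatest)
  have "transpose (mat a :: real ^ 'n ^ 'n) = mat a" "loewner_le (mat a :: real ^ 'n ^ 'n) (mat a)"
    "loewner_le (mat a :: real ^ 'n ^ 'n) (mat b)"
    using \<open>a \<le> b\<close> by (auto simp: transpose_mat loewner_le_def mat_mult_vec mult_right_mono)
  then show "{trace (A ** rank_one_shift \<alpha> e \<beta>) |A.
      transpose A = A \<and> loewner_le (mat a) A \<and> loewner_le A (mat b)} \<noteq> {}"
    by blast
next
  fix t assume "t \<in> {trace (A ** rank_one_shift \<alpha> e \<beta>) |A.
      transpose A = A \<and> loewner_le (mat a) A \<and> loewner_le A (mat b)}"
  then obtain A where A: "t = trace (A ** rank_one_shift \<alpha> e \<beta>)"
      "loewner_le (mat a) A" "loewner_le A (mat b)"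
    by blast
  have "e \<bullet> (mat a *v e) \<le> e \<bullet> (A *v e)"
    using A(2) unfolding loewner_le_def by blast
  then have "a \<le> e \<bullet> (A *v e)"
    using assms(1) by (simp add: mat_mult_vec dot_square_norm)
  then have "\<alpha> * a - \<beta> * (real CARD('n) * b) \<le> \<alpha> * (e \<bullet> (A *v e)) - \<beta> * trace A"
    using trace_le_of_loewner_le[OF A(3)] assms by (intro diff_mono mult_left_mono)
  then show "\<alpha> * a - \<beta> * (real CARD('n) * b) \<le> t"
    by (simp add: A(1) trace_mult_rank_one_shift)
qed

lemma quadratic_centered:
  fixes B :: "real ^ 'n ^ 'n::finite"
  assumes "transpose B = B"
  obtains c' v' where "\<And>y. c + v \<bullet> (y - x) + (y - x) \<bullet> (B *v (y - x)) / 2 = quadratic c' v' B y"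
proof
  fix y
  have "x \<bullet> (B *v y) = y \<bullet> (B *v x)"
    by (metis assms dot_lmul_matrix inner_commute transpose_matrix_vector)
  then show "c + v \<bullet> (y - x) + (y - x) \<bullet> (B *v (y - x)) / 2
      = quadratic (c - v \<bullet> x + x \<bullet> (B *v x) / 2) (v - B *v x) B y"
    by (simp add: quadratic_def matrix_vector_mult_diff_distrib inner_diff_left inner_diff_right
        inner_commute field_simps)
qed

text \<open>
  The squared aspect ratio of the cylinder, chosen so that the concave directions of the test
  function below cost at most half of what its convex direction contributes to the Pucci operator.
\<close>

definition cylinder_ratio :: "real \<Rightarrow> real \<Rightarrow> nat \<Rightarrow> real" where
  "cylinder_ratio lam Lam n = 8 * (real n)\<^sup>2 * Lam / lam"

definition cylinder_radius :: "real \<Rightarrow> real \<Rightarrow> nat \<Rightarrow> real" where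
  "cylinder_radius lam Lam n = 2 * sqrt (1 + cylinder_ratio lam Lam n)"

text \<open>
  After subtracting the support plane at \<open>x\<close>, the function is nonnegative, vanishes at \<open>x\<close> and
  grows with slope \<open>\<bar>p' - p\<bar>\<close> beyond distance \<open>r\<close>.  A quadratic that is convex in the direction
  of \<open>p' - p\<close> and slightly concave in the others fits below it on the boundary of a flat cylinder
  around \<open>x\<close> but not at \<open>x\<close>; sliding it down yields a contact point inside the cylinder.
\<close>

lemma support_slope_bound:
  fixes u f :: "real ^ 'n::finite \<Rightarrow> real"
  assumes lam: "0 < lam" "lam \<le> Lam"
    and super: "pucci_supersolution (lam / real CARD('n)) Lam f U u"
    and lsc: "lsc_on U u"
    and r: "0 < r" and sub: "cball x (cylinder_radius lam Lam CARD('n) * r) \<subseteq> U"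
    and x': "x' \<in> U" "dist x x' \<le> r"
    and p: "\<And>y. y \<in> U \<Longrightarrow> u x + p \<bullet> (y - x) \<le> u y"
    and p': "\<And>y. y \<in> U \<Longrightarrow> u x' + p' \<bullet> (y - x') \<le> u y"
    and f: "\<And>y. y \<in> cball x (cylinder_radius lam Lam CARD('n) * r) \<Longrightarrow> f y \<le> F" and F: "0 \<le> F"
  shows "norm (p' - p) \<le> 16 * real CARD('n) / lam * (r * F)"
proof (cases "p' = p")
  case True
  then show ?thesis using assms by simp
next
  case False
  define n where "n = real CARD('n)"
  define s where "s = cylinder_ratio lam Lam CARD('n)"
  define q where "q = norm (p' - p)"
  define e where "e = (1 / q) *\<^sub>R (p' - p)"
  \<comment> \<open>The cylinder has its axis through x in direction e: \<open>t\<close> is the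
    coordinate along the axis and \<open>\<sigma>\<close> the squared distance from it.\<close>
  define t where "t = (\<lambda>y. e \<bullet> (y - x))"
  define \<sigma> where "\<sigma> = (\<lambda>y. (norm (y - x))\<^sup>2 - (t y)\<^sup>2)"
  define \<alpha> where "\<alpha> = q / r * (1 / 8 + 1 / (2 * s))"
  define \<beta> where "\<beta> = q / r * (1 / (2 * s))"
  \<comment> \<open>This is the support plane at x plus q r times the bracket (t + 2 r)^2 / (16 r^2)
    - \<sigma> / (4 s r^2), and \<alpha>, \<beta> are read off from it. The bracket is 1/4 at x, at
    most 0 on the face t = -2 r and on the lateral boundary \<sigma> = 4 s r^2, and at most 1 on the
    face t = 2 r.\<close>
  define \<phi> where "\<phi> = (\<lambda>y. u x + q * r / 4 + (p + (q / 4) *\<^sub>R e) \<bullet> (y - x)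
      + (y - x) \<bullet> (rank_one_shift \<alpha> e \<beta> *v (y - x)) / 2)"
  define Z where "Z = {y. \<bar>t y\<bar> \<le> 2 * r \<and> \<sigma> y \<le> 4 * s * r\<^sup>2}"
  have n: "n \<ge> 1"
    by (simp add: n_def Suc_leI)
  have q: "q > 0" and e: "norm e = 1" and qe: "p' - p = q *\<^sub>R e"
    using False by (auto simp: q_def e_def)
  have s: "s > 0" and s_eq: "n * Lam / (2 * s) = lam / (16 * n)"
    using lam n by (auto simp: s_def cylinder_ratio_def n_def power2_eq_square field_simps)
  have crad: "cylinder_radius lam Lam CARD('n) = 2 * sqrt (1 + s)"
    by (simp add: cylinder_radius_def s_def)
  have \<phi>_eq: "\<phi> y = u x + p \<bullet> (y - x)
      + q * r * ((t y + 2 * r)\<^sup>2 / (16 * r\<^sup>2) - \<sigma> y / (4 * s * r\<^sup>2))" for y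
  proof -
    have "(y - x) \<bullet> (rank_one_shift \<alpha> e \<beta> *v (y - x)) = \<alpha> * (t y)\<^sup>2 - \<beta> * (norm (y - x))\<^sup>2"
      unfolding rank_one_shift_mult_vec t_def
      by (simp add: inner_diff_right[of "y - x"] inner_commute[of "y - x" e] dot_square_norm
          power2_eq_square[of "e \<bullet> _"])
    moreover have "(p + (q / 4) *\<^sub>R e) \<bullet> (y - x) = p \<bullet> (y - x) + q / 4 * t y"
      by (simp add: inner_add_left t_def)
    ultimately have "\<phi> y = u x + q * r / 4 + (p \<bullet> (y - x) + q / 4 * t y)
        + (\<alpha> * (t y)\<^sup>2 - \<beta> * (norm (y - x))\<^sup>2) / 2"
      unfolding \<phi>_def by simp
    also have "\<dots> = u x + p \<bullet> (y - x)
        + q * r * ((t y + 2 * r)\<^sup>2 / (16 * r\<^sup>2) - \<sigma> y / (4 * s * r\<^sup>2))"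
      using r s unfolding \<sigma>_def \<alpha>_def \<beta>_def by (simp add: field_simps power2_eq_square)
    finally show ?thesis .
  qed
  have cont_t: "continuous_on A t" and cont_\<sigma>: "continuous_on A \<sigma>" for A
    unfolding t_def \<sigma>_def by (intro continuous_intros)+
  have Z_sub: "Z \<subseteq> cball x (cylinder_radius lam Lam CARD('n) * r)"
  proof
    fix y assume "y \<in> Z"
    then have "\<bar>t y\<bar> \<le> 2 * r" "\<sigma> y \<le> 4 * s * r\<^sup>2"
      by (auto simp: Z_def)
    then have "(t y)\<^sup>2 \<le> (2 * r)\<^sup>2"
      using abs_le_square_iff[of "t y" "2 * r"] r by simp
    then have "(norm (y - x))\<^sup>2 \<le> (2 * r)\<^sup>2 + 4 * s * r\<^sup>2"
      using \<open>\<sigma> y \<le> _\<close> unfolding \<sigma>_def by linarith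
    also have "\<dots> = (cylinder_radius lam Lam CARD('n) * r)\<^sup>2"
      unfolding crad power_mult_distrib using s by (simp add: distrib_left distrib_right)
    finally have "norm (y - x) \<le> cylinder_radius lam Lam CARD('n) * r"
      by (rule power2_le_imp_le) (use s r in \<open>simp add: crad\<close>)
    then show "y \<in> cball x (cylinder_radius lam Lam CARD('n) * r)"
      by (simp add: dist_norm norm_minus_commute)
  qed
  have "closed Z"
    unfolding Z_def by (intro closed_Collect_conj closed_Collect_le continuous_intros cont_t cont_\<sigma>)
  then have "compact Z"
    using Z_sub compact_cball compact_Int_closed inf.absorb_iff2 by (metis inf_commute)
  have "x \<in> Z"
    using r s by (simp add: Z_def t_def \<sigma>_def)
  have "lsc_on Z (\<lambda>y. u y + - \<phi> y)"
  proof (rule lsc_on_add_continuous)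
    show "lsc_on Z u"
      using lsc_on_subset[OF lsc] Z_sub sub by blast
    show "continuous_on Z (\<lambda>y. - \<phi> y)"
      unfolding \<phi>_eq using r s by (intro continuous_intros cont_t cont_\<sigma>) auto
  qed
  then obtain z where z: "z \<in> Z" "\<And>y. y \<in> Z \<Longrightarrow> u z - \<phi> z \<le> u y - \<phi> y"
    using lsc_on_attains_inf[OF \<open>compact Z\<close>] \<open>x \<in> Z\<close> by fastforce
  have "u x - \<phi> x < 0"
    using q r by (simp add: \<phi>_def)
  then have neg: "u z < \<phi> z"
    using z(2)[OF \<open>x \<in> Z\<close>] by linarith
  have zU: "z \<in> U" and xU: "x \<in> U"
    using z \<open>x \<in> Z\<close> Z_sub sub by auto
  have low1: "u x + p \<bullet> (z - x) \<le> u z"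
    using p zU by blast
  \<comment> \<open>The plane of slope p' is not below the first one at x', and gains q per unit of
    length along e relative to it. Since x' is within r of x, the gain at z is at least q (t z - r),
    which is q r on the face t = 2 r.\<close>
  have low2: "u x + p \<bullet> (z - x) + q * (t z - r) \<le> u z"
  proof -
    have "u x + p \<bullet> (x' - x) + p' \<bullet> (z - x') \<le> u z"
      using p[OF x'(1)] p'[OF zU] by linarith
    moreover have "p \<bullet> (x' - x) + p' \<bullet> (z - x') = p \<bullet> (z - x) + (p' - p) \<bullet> ((z - x) - (x' - x))"
      by (simp add: algebra_simps)
    moreover have "(p' - p) \<bullet> ((z - x) - (x' - x)) = q * (t z - e \<bullet> (x' - x))"
      unfolding qe t_def by (simp only: inner_scaleR_left inner_diff_right[of e "z - x" "x' - x"])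
    moreover have "e \<bullet> (x' - x) \<le> r"
      using norm_cauchy_schwarz[of e "x' - x"] e x'(2) by (simp add: dist_norm norm_minus_commute)
    then have "q * (t z - r) \<le> q * (t z - e \<bullet> (x' - x))"
      using q by (intro mult_left_mono) auto
    ultimately show ?thesis by linarith
  qed
  have tz: "\<bar>t z\<bar> \<le> 2 * r" and \<sigma>z: "\<sigma> z \<le> 4 * s * r\<^sup>2"
    using z by (auto simp: Z_def)
  have \<sigma>_nonneg: "\<sigma> z \<ge> 0"
  proof -
    have "\<bar>t z\<bar> \<le> norm (z - x)"
      using Cauchy_Schwarz_ineq2[of e "z - x"] unfolding t_def e by simp
    then have "\<bar>t z\<bar>\<^sup>2 \<le> (norm (z - x))\<^sup>2"
      by (rule power_mono) simp
    then show ?thesis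
      unfolding \<sigma>_def by simp
  qed
  \<comment> \<open>As \<phi> is above u, hence above the first plane, at z, the bracket is positive
    there. This excludes the lateral boundary and the face t = -2 r; the face t = 2 r is excluded by
    the second plane.\<close>
  have gap: "(t z + 2 * r)\<^sup>2 / (16 * r\<^sup>2) - \<sigma> z / (4 * s * r\<^sup>2) > 0"
  proof (rule zero_less_mult_pos)
    show "0 < q * r * ((t z + 2 * r)\<^sup>2 / (16 * r\<^sup>2) - \<sigma> z / (4 * s * r\<^sup>2))"
      using neg low1 \<phi>_eq[of z] by linarith
  qed (use q r in simp)
  have sq: "(t z + 2 * r)\<^sup>2 / (16 * r\<^sup>2) \<le> 1"
  proof -
    have "(t z + 2 * r)\<^sup>2 \<le> (4 * r)\<^sup>2"
      using tz r by (intro power_mono) auto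
    then show ?thesis
      using r by (simp add: power_mult_distrib)
  qed
  have "\<sigma> z < 4 * s * r\<^sup>2"
  proof -
    have "\<sigma> z / (4 * s * r\<^sup>2) < 1"
      using gap sq by linarith
    then show ?thesis using s r by (simp add: divide_less_eq)
  qed
  moreover have "t z \<noteq> - (2 * r)"
  proof
    assume "t z = - (2 * r)"
    then have "- \<sigma> z / (4 * s * r\<^sup>2) > 0"
      using gap by simp
    moreover have "\<sigma> z / (4 * s * r\<^sup>2) \<ge> 0"
      using \<sigma>_nonneg s r by simp
    ultimately show False by simp
  qed
  moreover have "t z \<noteq> 2 * r"
  proof
    assume "t z = 2 * r"
    then have "q * r < q * r * ((t z + 2 * r)\<^sup>2 / (16 * r\<^sup>2) - \<sigma> z / (4 * s * r\<^sup>2))"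
      using low2 neg \<phi>_eq[of z] by simp
    also have "\<dots> \<le> q * r * 1"
      using sq \<sigma>_nonneg s r q by (intro mult_left_mono) (auto intro: order_trans[of _ "(t z + 2 * r)\<^sup>2 / (16 * r\<^sup>2)"])
    finally show False by simp
  qed
  ultimately have "z \<in> {y. \<bar>t y\<bar> < 2 * r \<and> \<sigma> y < 4 * s * r\<^sup>2}"
    using tz by auto
  moreover have "open {y. \<bar>t y\<bar> < 2 * r \<and> \<sigma> y < 4 * s * r\<^sup>2}"
    by (intro open_Collect_conj open_Collect_less continuous_intros cont_t cont_\<sigma>)
  ultimately have ev: "\<forall>\<^sub>F y in nhds z. y \<in> {y. \<bar>t y\<bar> < 2 * r \<and> \<sigma> y < 4 * s * r\<^sup>2}"
    using eventually_nhds_in_open by blast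
  obtain c v where cv: "\<And>y. (u x + q * r / 4 + (u z - \<phi> z)) + (p + (q / 4) *\<^sub>R e) \<bullet> (y - x)
      + (y - x) \<bullet> (rank_one_shift \<alpha> e \<beta> *v (y - x)) / 2 = quadratic c v (rank_one_shift \<alpha> e \<beta>) y"
    using quadratic_centered[OF transpose_rank_one_shift] by metis
  have quad: "quadratic c v (rank_one_shift \<alpha> e \<beta>) y = \<phi> y + (u z - \<phi> z)" for y
    unfolding cv[symmetric] \<phi>_def by simp
  have "touches_below (quadratic c v (rank_one_shift \<alpha> e \<beta>)) u z"
    unfolding touches_below_def quad
  proof
    show "\<forall>\<^sub>F y in nhds z. \<phi> y + (u z - \<phi> z) \<le> u y"
      using ev
    proof eventually_elim
      case (elim y)
      then have "y \<in> Z" by (auto simp: Z_def)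
      then show ?case using z(2) by fastforce
    qed
  qed simp
  then have "pucci_min (rank_one_shift \<alpha> e \<beta>) (lam / n) Lam \<le> f z"
    using super zU transpose_rank_one_shift unfolding pucci_supersolution_def n_def by blast
  moreover have "\<alpha> * (lam / n) - \<beta> * (n * Lam) \<le> pucci_min (rank_one_shift \<alpha> e \<beta>) (lam / n) Lam"
    unfolding n_def
  proof (rule pucci_min_rank_one_shift_ge[OF e])
    show "lam / real CARD('n) \<le> Lam"
      using lam n mult_mono[of 1 n lam Lam] unfolding n_def by (simp add: divide_le_eq mult.commute)
  qed (use q r s in \<open>auto simp: \<alpha>_def \<beta>_def\<close>)
  \<comment> \<open>The direction e contributes at least q \<lambda> / (8 n r), and the concave part
    costs q \<lambda> / (16 n r) by the choice of s.\<close>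
  moreover have "q * lam / (16 * n * r) \<le> \<alpha> * (lam / n) - \<beta> * (n * Lam)"
  proof -
    have "\<beta> * (n * Lam) = q / r * (lam / (16 * n))"
      unfolding s_eq[symmetric] \<beta>_def by simp
    moreover have "\<alpha> * (lam / n) \<ge> q / r * (1 / 8) * (lam / n)"
      unfolding \<alpha>_def using q r s lam n by (intro mult_right_mono mult_left_mono) auto
    moreover have "q / r * (1 / 8) * (lam / n) - q / r * (lam / (16 * n)) = q * lam / (16 * n * r)"
      using n r by (simp add: field_simps)
    ultimately show ?thesis by linarith
  qed
  moreover have "f z \<le> F"
    using f z Z_sub by blast
  ultimately have "q * lam / (16 * n * r) \<le> F"
    by linarith
  then show ?thesis
    using lam n r unfolding q_def[symmetric] n_def[symmetric] by (simp add: field_simps)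
qed

section \<open>Volume of the set of slopes\<close>

text \<open>The image of A under the subdifferential of u relative to U.\<close>

definition support_slopes ::
    "('a::real_inner \<Rightarrow> real) \<Rightarrow> 'a set \<Rightarrow> 'a set \<Rightarrow> 'a set" where
  "support_slopes u U A = {p. \<exists>x\<in>A. \<forall>y\<in>U. u x + p \<bullet> (y - x) \<le> u y}"

section \<open>Comparison of measures and outer regularity\<close>

lemma emeasure_UN_le_disjoint:
  assumes "countable I" "\<And>i. i \<in> I \<Longrightarrow> X i \<in> sets M" "\<And>i. i \<in> I \<Longrightarrow> Y i \<in> sets N"
    and "disjoint_family_on Y I" "\<And>i. i \<in> I \<Longrightarrow> emeasure M (X i) \<le> emeasure N (Y i)"
  shows "emeasure M (\<Union>i\<in>I. X i) \<le> emeasure N (\<Union>i\<in>I. Y i)"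
proof -
  define J where "J = to_nat_on I ` I"
  define X' where "X' = (\<lambda>n. if n \<in> J then X (from_nat_into I n) else {})"
  define Y' where "Y' = (\<lambda>n. if n \<in> J then Y (from_nat_into I n) else {})"
  have J: "from_nat_into I n \<in> I" if "n \<in> J" for n
    using that \<open>countable I\<close> by (auto simp: J_def)
  have inj: "m = n" if "m \<in> J" "n \<in> J" "from_nat_into I m = from_nat_into I n" for m n
    using that \<open>countable I\<close> by (auto simp: J_def)
  have X': "(\<Union>n. X' n) = (\<Union>i\<in>I. X i)" and Y': "(\<Union>n. Y' n) = (\<Union>i\<in>I. Y i)"
    using \<open>countable I\<close> by (auto simp: X'_def Y'_def J_def split: if_splits)
  have "disjoint_family Y'"
    using assms(4) inj J unfolding disjoint_family_on_def Y'_def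
    by (auto split: if_splits) blast
  have "emeasure M (\<Union>n. X' n) \<le> (\<Sum>n. emeasure M (X' n))"
    using assms(2) J by (intro emeasure_subadditive_countably) (auto simp: X'_def)
  also have "\<dots> \<le> (\<Sum>n. emeasure N (Y' n))"
    using assms(5) J by (intro suminf_le) (auto simp: X'_def Y'_def)
  also have "\<dots> = emeasure N (\<Union>n. Y' n)"
    using assms(3) J \<open>disjoint_family Y'\<close> by (intro suminf_emeasure) (auto simp: Y'_def)
  finally show ?thesis by (simp add: X' Y')
qed

text \<open>Outer regularity for the density h, which may be unbounded on U. On the open set where h
  < j + 1, the set A is enlarged by measure at most \<open>d j\<close>, chosen so that this adds at
  most e / 2^(j+1) to the integral.\<close>

lemma nn_integral_outer_open:
  fixes h :: "'a::euclidean_space \<Rightarrow> real"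
  assumes "open U" "continuous_on U h" "A \<subseteq> U" "A \<in> sets borel" "0 < e"
  obtains V where "open V" "A \<subseteq> V" "V \<subseteq> U"
    "(\<integral>\<^sup>+x\<in>V. ennreal (h x) \<partial>lborel) \<le> (\<integral>\<^sup>+x\<in>A. ennreal (h x) \<partial>lborel) + ennreal e"
proof -
  define O' where "O' = (\<lambda>j::nat. {x \<in> U. h x < real j + 1})"
  have opO: "open (O' j)" for j
  proof -
    have "O' j = U \<inter> h -` {..<real j + 1}"
      by (auto simp: O'_def)
    then show ?thesis
      using continuous_open_preimage[OF assms(2,1) open_lessThan] by simp
  qed
  define d where "d = (\<lambda>j::nat. e * (1 / 2) ^ Suc j / (real j + 1))"
  have d: "d j > 0" for j
    using \<open>0 < e\<close> by (simp add: d_def)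
  have "\<exists>T. open T \<and> A \<inter> O' j \<subseteq> T \<and> emeasure lborel (T - A \<inter> O' j) \<le> ennreal (d j)" for j
  proof -
    have AO: "A \<inter> O' j \<in> sets borel"
      using assms(4) opO by auto
    obtain T where "open T" "A \<inter> O' j \<subseteq> T" "emeasure lebesgue (T - A \<inter> O' j) < ennreal (d j)"
      by (rule sets_lebesgue_outer_open[of "A \<inter> O' j" "d j"]) (use AO d in auto)
    then show ?thesis
      using AO by (intro exI[of _ T]) (simp add: less_imp_le borel_open)
  qed
  then obtain T where T: "\<And>j. open (T j)" "\<And>j. A \<inter> O' j \<subseteq> T j"
      "\<And>j. emeasure lborel (T j - A \<inter> O' j) \<le> ennreal (d j)"
    by metis
  define V where "V = (\<Union>j. T j \<inter> O' j)"
  have [measurable]: "T j \<in> sets borel" "O' j \<in> sets borel" "A \<in> sets borel" for j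
    using T opO assms(4) by auto
  have V: "open V"
    unfolding V_def using T(1) opO by (intro open_UN open_Int ballI)
  then have [measurable]: "V \<in> sets borel" by simp
  have VU: "V \<subseteq> U"
    by (auto simp: V_def O'_def)
  have AV: "A \<subseteq> V"
  proof
    fix x assume x: "x \<in> A"
    obtain j :: nat where "h x < real j + 1"
      using reals_Archimedean2[of "h x"] by (meson less_add_one less_trans)
    then have "x \<in> O' j"
      using x assms(3) by (auto simp: O'_def)
    then show "x \<in> V"
      using x T(2) by (auto simp: V_def)
  qed
  have "continuous_on V h"
    using assms(2) VU continuous_on_subset by blast
  then have [measurable]: "(\<lambda>x. indicator V x * h x) \<in> borel_measurable borel"
    unfolding real_scaleR_def[symmetric] by (intro borel_measurable_continuous_on_indicator) auto
  define H where "H = (\<lambda>x. ennreal (indicator V x * h x))"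
  have Hm[measurable]: "H \<in> borel_measurable lborel"
    unfolding H_def by simp
  have H: "H x = ennreal (h x)" if "x \<in> V" for x
    using that by (simp add: H_def)
  have "(\<integral>\<^sup>+x\<in>V. ennreal (h x) \<partial>lborel) = (\<integral>\<^sup>+x\<in>V. H x \<partial>lborel)"
    by (intro nn_integral_cong) (auto simp: H split: split_indicator)
  also have "\<dots> \<le> (\<integral>\<^sup>+x. H x * indicator A x +
      (\<Sum>j. ennreal (real j + 1) * indicator (T j - A \<inter> O' j) x) \<partial>lborel)"
  proof (rule nn_integral_mono)
    fix x
    show "H x * indicator V x \<le> H x * indicator A x +
      (\<Sum>j. ennreal (real j + 1) * indicator (T j - A \<inter> O' j) x)"
    proof (cases "x \<in> V \<and> x \<notin> A")
      case True
      \<comment> \<open>Outside A, the single term of index j already bounds h, because x lies in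
        \<open>T j - A \<inter> O' j\<close> and h x < j + 1.\<close>
      then obtain j where j: "x \<in> T j" "x \<in> O' j" by (auto simp: V_def)
      have "H x * indicator V x = ennreal (h x)"
        using True H by simp
      also have "\<dots> \<le> ennreal (real j + 1)"
        using j by (intro ennreal_leI) (auto simp: O'_def)
      also have "\<dots> = (\<Sum>i\<in>{j}. ennreal (real i + 1) * indicator (T i - A \<inter> O' i) x)"
        using True j by simp
      also have "\<dots> \<le> (\<Sum>i. ennreal (real i + 1) * indicator (T i - A \<inter> O' i) x)"
        by (intro sum_le_suminf) auto
      finally show ?thesis
        using True by simp
    next
      case False
      then show ?thesis by (auto split: split_indicator)
    qed
  qed
  also have "\<dots> = (\<integral>\<^sup>+x\<in>A. H x \<partial>lborel) +
      (\<Sum>j. ennreal (real j + 1) * emeasure lborel (T j - A \<inter> O' j))"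
    by (simp add: nn_integral_add nn_integral_suminf nn_integral_cmult_indicator)
  also have "(\<integral>\<^sup>+x\<in>A. H x \<partial>lborel) = (\<integral>\<^sup>+x\<in>A. ennreal (h x) \<partial>lborel)"
    using AV by (intro nn_integral_cong) (auto simp: H split: split_indicator)
  also have "(\<Sum>j. ennreal (real j + 1) * emeasure lborel (T j - A \<inter> O' j))
      \<le> (\<Sum>j. ennreal (e * (1 / 2) ^ Suc j))"
  proof (intro suminf_le)
    fix j
    have "ennreal (real j + 1) * emeasure lborel (T j - A \<inter> O' j) \<le> ennreal (real j + 1) * ennreal (d j)"
      using T(3) by (intro mult_left_mono) auto
    also have "\<dots> = ennreal ((real j + 1) * d j)"
      using d[of j] by (simp add: ennreal_mult'' less_imp_le)
    also have "(real j + 1) * d j = e * (1 / 2) ^ Suc j"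
    proof -
      have "real j + 1 \<noteq> 0"
        by linarith
      then show ?thesis
        unfolding d_def by (metis nonzero_mult_div_cancel_left times_divide_eq_right)
    qed
    finally show "ennreal (real j + 1) * emeasure lborel (T j - A \<inter> O' j) \<le> ennreal (e * (1 / 2) ^ Suc j)" .
  qed auto
  also have "(\<Sum>j. ennreal (e * (1 / 2) ^ Suc j)) = ennreal e"
  proof (rule suminf_ennreal_eq)
    show "(\<lambda>j. e * (1 / 2) ^ Suc j) sums e"
      using sums_mult[OF power_half_series, of e] by simp
  qed (use \<open>0 < e\<close> in simp)
  finally show ?thesis
    using that[OF V AV VU] by (simp add: add_left_mono)
qed

text \<open>
  \<open>slope_volume lam n * F ^ n * s ^ n\<close> is the volume of a ball of radius \<open>16 n / lam * (r * F)\<close> with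
  \<open>r = n * s\<close>, a bound for the diameter of a cube of side \<open>s\<close>.
\<close>

definition slope_volume :: "real \<Rightarrow> nat \<Rightarrow> real" where
  "slope_volume lam n = unit_ball_vol (real n) * (16 * (real n)\<^sup>2 / lam) ^ n"

lemma slope_volume_nonneg: "0 < lam \<Longrightarrow> 0 \<le> slope_volume lam n"
  by (simp add: slope_volume_def unit_ball_vol_nonneg)

section \<open>Covering the contact set by small cubes\<close>

lemma dist_le_of_mem_cube:
  fixes c d x y :: "real ^ 'n::finite"
  assumes "\<And>i. d $ i - c $ i = s" "x \<in> cbox c d" "y \<in> cbox c d"
  shows "dist x y \<le> real CARD('n) * s"
proof -
  have "\<bar>(x - y) $ i\<bar> \<le> s" for i
    using assms(1)[of i] assms(2,3) unfolding mem_box_cart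
    by (smt (verit) vector_minus_component)
  then have "(\<Sum>i\<in>UNIV. \<bar>(x - y) $ i\<bar>) \<le> (\<Sum>i\<in>(UNIV :: 'n set). s)"
    by (intro sum_mono)
  then show ?thesis
    using norm_le_l1_cart[of "x - y"] by (simp add: dist_norm)
qed

text \<open>Points of the cube are within r = n s of each other, so by
  \<open>support_slope_bound\<close> all slopes lie in one ball around any of them. The condition on
  \<rho> keeps the cylinder around each contact point of the cube inside the ball about z, where F
  bounds f.\<close>

lemma support_slopes_cube:
  fixes u f :: "real ^ 'n::finite \<Rightarrow> real"
  assumes lam: "0 < lam" "lam \<le> Lam"
    and super: "pucci_supersolution (lam / real CARD('n)) Lam f U u" and lsc: "lsc_on U u"
    and A: "A \<subseteq> U" and cube: "\<And>i. d $ i - c $ i = s" "0 < s" and z: "z \<in> cbox c d"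
    and rho: "(cylinder_radius lam Lam CARD('n) + 1) * (real CARD('n) * s) < \<rho>" "ball z \<rho> \<subseteq> U"
    and F: "\<And>y. y \<in> ball z \<rho> \<Longrightarrow> f y \<le> F" "0 \<le> F"
  shows "\<exists>p r. support_slopes u U (A \<inter> cbox c d) \<subseteq> cball p r \<and>
    emeasure lborel (cball p r) \<le> ennreal (slope_volume lam CARD('n) * F ^ CARD('n)) * emeasure lborel (box c d)"
proof (cases "support_slopes u U (A \<inter> cbox c d) = {}")
  case True
  \<comment> \<open>A negative radius gives the empty ball.\<close>
  then show ?thesis by (intro exI[of _ 0] exI[of _ "-1"]) simp
next
  case False
  define r where "r = real CARD('n) * s"
  have r: "0 < r"
    using cube(2) by (simp add: r_def)
  obtain p x where x: "x \<in> A" "x \<in> cbox c d" and p: "\<And>y. y \<in> U \<Longrightarrow> u x + p \<bullet> (y - x) \<le> u y"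
    using False by (auto simp: support_slopes_def)
  have dist: "dist v w \<le> r" if "v \<in> cbox c d" "w \<in> cbox c d" for v w
    using dist_le_of_mem_cube[OF cube(1) that] by (simp add: r_def)
  have sub: "cball x (cylinder_radius lam Lam CARD('n) * r) \<subseteq> ball z \<rho>"
  proof
    fix y assume "y \<in> cball x (cylinder_radius lam Lam CARD('n) * r)"
    then have "dist z y \<le> r + cylinder_radius lam Lam CARD('n) * r"
      using dist[OF z x(2)] dist_triangle[of z y x] by simp
    then show "y \<in> ball z \<rho>"
      using rho(1) by (simp add: r_def algebra_simps)
  qed
  define R where "R = 16 * real CARD('n) / lam * (r * F)"
  have "support_slopes u U (A \<inter> cbox c d) \<subseteq> cball p R"
  proof
    fix p' assume "p' \<in> support_slopes u U (A \<inter> cbox c d)"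
    then obtain x' where x': "x' \<in> A" "x' \<in> cbox c d" and p': "\<And>y. y \<in> U \<Longrightarrow> u x' + p' \<bullet> (y - x') \<le> u y"
      by (auto simp: support_slopes_def)
    have "norm (p' - p) \<le> R"
      unfolding R_def
    proof (rule support_slope_bound[OF lam super lsc r, of x x'])
      show "cball x (cylinder_radius lam Lam CARD('n) * r) \<subseteq> U"
        using sub rho(2) by blast
      show "f y \<le> F" if "y \<in> cball x (cylinder_radius lam Lam CARD('n) * r)" for y
        using F(1) sub that by blast
    qed (use dist x x' A p p' F(2) in auto)
    then show "p' \<in> cball p R"
      by (simp add: dist_norm norm_minus_commute)
  qed
  moreover have "emeasure lborel (cball p R) = ennreal (slope_volume lam CARD('n) * F ^ CARD('n)) * emeasure lborel (box c d)"
  proof -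
    have "c \<bullet> b \<le> d \<bullet> b" "(d - c) \<bullet> b = s" if "b \<in> Basis" for b
      using that cube by (auto simp: Basis_vec_def inner_axis) (smt (verit) cube)
    then have "emeasure lborel (box c d) = ennreal (\<Prod>b\<in>(Basis :: (real ^ 'n) set). s)"
      by (simp add: emeasure_lborel_box)
    then have box: "emeasure lborel (box c d) = ennreal (s ^ CARD('n))"
      by simp
    have "0 \<le> R"
      using lam r F by (simp add: R_def)
    then have "emeasure lborel (cball p R) = ennreal (unit_ball_vol (real CARD('n)) * R ^ CARD('n))"
      by (simp add: emeasure_cball)
    also have "unit_ball_vol (real CARD('n)) * R ^ CARD('n) = slope_volume lam CARD('n) * F ^ CARD('n) * s ^ CARD('n)"
      by (simp add: slope_volume_def R_def r_def power_mult_distrib power2_eq_square power_divide field_simps)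
    finally show ?thesis
      using cube(2) by (simp add: box ennreal_mult'')
  qed
  ultimately show ?thesis by (metis order_refl)
qed

text \<open>\<open>covering_lemma\<close> yields nonoverlapping cubes, each inside the gauge ball of
  one of its points z in A. Near z the positive part F of f varies by less than \<eta>, so F z +
  \<eta> bounds f there and is at most F + 2 \<eta> on the cube; the estimates for single cubes then
  add up to an integral over V. The slopes are enclosed in a countable union of closed balls, which
  is measurable.\<close>

lemma support_slopes_cover_open:
  fixes u f :: "real ^ 'n::finite \<Rightarrow> real"
  assumes lam: "0 < lam" "lam \<le> Lam"
    and super: "pucci_supersolution (lam / real CARD('n)) Lam f U u" and lsc: "lsc_on U u"
    and V: "open V" "A \<subseteq> V" "V \<subseteq> U" and "bounded U"
    and f: "continuous_on U f" and "0 < \<eta>"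
  obtains D where "D \<in> sets lborel" "support_slopes u U A \<subseteq> D"
    "emeasure lborel D \<le> ennreal (slope_volume lam CARD('n)) *
       (\<integral>\<^sup>+x\<in>V. ennreal ((pos_part (f x) + 2 * \<eta>) ^ CARD('n)) \<partial>lborel)"
proof -
  define n where "n = CARD('n)"
  define F where "F = (\<lambda>x. pos_part (f x))"
  define \<kappa> where "\<kappa> = cylinder_radius lam Lam n"
  have n: "n \<ge> 1"
    by (simp add: n_def Suc_leI)
  have \<kappa>: "\<kappa> \<ge> 0"
    using lam by (simp add: \<kappa>_def cylinder_radius_def cylinder_ratio_def)
  have F: "continuous_on U F" and F0: "F x \<ge> 0" and fF: "f x \<le> F x" for x
    using f unfolding F_def pos_part_def by (auto intro!: continuous_intros)
  obtain B where B: "B > 0" "\<And>x. x \<in> U \<Longrightarrow> norm x \<le> B"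
    using \<open>bounded U\<close> bounded_pos by blast
  define a b :: "real ^ 'n" where "a = (\<chi> i. - B)" and "b = (\<chi> i. B)"
  have AU: "A \<subseteq> cbox a b"
  proof
    fix x assume "x \<in> A"
    then have "\<bar>x $ i\<bar> \<le> B" for i
      using B(2)[of x] V component_le_norm_cart[of x i] by (meson order_trans subsetD)
    then show "x \<in> cbox a b"
      unfolding mem_box_cart a_def b_def by (simp add: abs_le_iff minus_le_iff)
  qed
  have ab: "box a b \<noteq> {}"
  proof -
    have "(0 :: real ^ 'n) \<in> box a b"
      using B(1) by (simp add: mem_box_cart a_def b_def)
    then show ?thesis by blast
  qed
  have "\<exists>\<rho>>0. ball x \<rho> \<subseteq> V \<and> (\<forall>y\<in>ball x \<rho>. \<bar>F y - F x\<bar> < \<eta>)" if "x \<in> V" for x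
  proof -
    obtain \<rho>1 where \<rho>1: "\<rho>1 > 0" "ball x \<rho>1 \<subseteq> V"
      using V(1) \<open>x \<in> V\<close> openE by blast
    obtain \<rho>2 where \<rho>2: "\<rho>2 > 0" "\<And>y. y \<in> U \<Longrightarrow> dist y x < \<rho>2 \<Longrightarrow> dist (F y) (F x) < \<eta>"
      using F \<open>0 < \<eta>\<close> \<open>x \<in> V\<close> V(3) unfolding continuous_on_iff by (metis subsetD)
    show ?thesis
    proof (intro exI[of _ "min \<rho>1 \<rho>2"] conjI ballI)
      show "ball x (min \<rho>1 \<rho>2) \<subseteq> V"
        using \<rho>1 by auto
      fix y assume "y \<in> ball x (min \<rho>1 \<rho>2)"
      then show "\<bar>F y - F x\<bar> < \<eta>"
        using \<rho>2(2)[of y] \<rho>1 V(3) by (force simp: dist_real_def dist_commute)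
    qed (use \<rho>1 \<rho>2 in simp)
  qed
  then obtain \<rho> where \<rho>: "\<And>x. x \<in> V \<Longrightarrow> \<rho> x > 0 \<and> ball x (\<rho> x) \<subseteq> V \<and> (\<forall>y\<in>ball x (\<rho> x). \<bar>F y - F x\<bar> < \<eta>)"
    by metis
  \<comment> \<open>A cube inside the ball of radius \<rho> z / N about z has side s below 2 \<rho>
    z / N. With this N the bound reads (\<kappa> + 1) n s < \<rho> z, the room required by
    \<open>support_slopes_cube\<close>.\<close>
  define N where "N = 2 * (\<kappa> + 1) * real n"
  have N: "N \<ge> 1"
    using n \<kappa> mult_mono[of 1 "2 * (\<kappa> + 1)" 1 "real n"] by (simp add: N_def)
  \<comment> \<open>A gauge is defined at every point; since A lies in V, the radius chosen outside
    V is immaterial.\<close>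
  define \<gamma> where "\<gamma> = (\<lambda>x. if x \<in> V then ball x (\<rho> x / N) else ball x 1)"
  have "gauge \<gamma>"
    unfolding gauge_def \<gamma>_def using \<rho> N by auto
  obtain \<D> where \<D>: "countable \<D>" "\<And>K. K \<in> \<D> \<Longrightarrow> interior K \<noteq> {} \<and> (\<exists>c d. K = cbox c d)"
    "pairwise (\<lambda>A B. interior A \<inter> interior B = {}) \<D>"
    "\<And>K. K \<in> \<D> \<Longrightarrow> \<exists>x \<in> A \<inter> K. K \<subseteq> \<gamma> x"
    "\<And>u v. cbox u v \<in> \<D> \<Longrightarrow> \<exists>n. \<forall>i \<in> Basis. v \<bullet> i - u \<bullet> i = (b \<bullet> i - a \<bullet> i) / 2^n"
    "A \<subseteq> \<Union>\<D>"
    using covering_lemma[OF AU ab \<open>gauge \<gamma>\<close>] by metis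
  define h where "h = (\<lambda>x. slope_volume lam n * (F x + 2 * \<eta>) ^ n)"
  \<comment> \<open>The indicator stands inside \<open>ennreal\<close> because continuity of h, and
    so measurability, is known on V only.\<close>
  define H where "H = (\<lambda>x. ennreal (indicator V x * h x))"
  define \<nu> where "\<nu> = density lborel H"
  have [measurable]: "V \<in> sets borel"
    using V(1) by simp
  have "continuous_on V h"
    unfolding h_def using F V(3) by (intro continuous_intros) (rule continuous_on_subset)
  then have [measurable]: "(\<lambda>x. indicator V x * h x) \<in> borel_measurable borel"
    unfolding real_scaleR_def[symmetric] by (intro borel_measurable_continuous_on_indicator) auto
  have [measurable]: "H \<in> borel_measurable lborel"
    unfolding H_def by simp
  have "\<exists>p r. support_slopes u U (A \<inter> K) \<subseteq> cball p r \<and>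
      interior K \<subseteq> V \<and> emeasure lborel (cball p r) \<le> emeasure \<nu> (interior K)"
    if "K \<in> \<D>" for K
  proof -
    obtain c d where K: "K = cbox c d"
      using \<D>(2) \<open>K \<in> \<D>\<close> by blast
    have cd: "box c d \<noteq> {}"
      using \<D>(2)[OF \<open>K \<in> \<D>\<close>] by (simp add: K interior_cbox)
    obtain m where m: "\<forall>i \<in> Basis. d \<bullet> i - c \<bullet> i = (b \<bullet> i - a \<bullet> i) / 2^m"
      using \<D>(5) \<open>K \<in> \<D>\<close> K by blast
    define s where "s = 2 * B / 2 ^ m"
    have side: "d $ i - c $ i = s" for i
      using bspec[OF m, of "axis i 1"] by (auto simp: inner_axis s_def a_def b_def Basis_vec_def)
    have s: "s > 0"
      using B by (simp add: s_def)
    obtain z where z: "z \<in> A" "z \<in> K" "K \<subseteq> \<gamma> z"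
      using \<D>(4) \<open>K \<in> \<D>\<close> by blast
    then have zV: "z \<in> V"
      using V by blast
    then have Kz: "K \<subseteq> ball z (\<rho> z / N)"
      using z by (simp add: \<gamma>_def)
    have "ball z (\<rho> z / N) \<subseteq> ball z (\<rho> z)"
      using \<rho>[OF zV] N by (intro subset_ball) (simp add: divide_le_eq mult_le_cancel_left1)
    then have K\<rho>: "K \<subseteq> ball z (\<rho> z)"
      using Kz by blast
    have KV: "interior K \<subseteq> V"
      using K\<rho> \<rho>[OF zV] interior_subset by blast
    have cd_le: "c $ i \<le> d $ i" for i
      using side[of i] s by linarith
    have "c \<in> K" "d \<in> K"
      using cd_le by (auto simp: K mem_box_cart)
    then have "dist c d < 2 * (\<rho> z / N)"
      using Kz dist_triangle3[of c d z] by (smt (verit) mem_ball subsetD)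
    moreover have "s \<le> dist c d"
      using component_le_norm_cart[of "d - c" undefined] side s by (simp add: dist_norm norm_minus_commute)
    ultimately have "N * s < 2 * \<rho> z"
    proof -
      have "N * s \<le> N * dist c d"
        using N \<open>s \<le> dist c d\<close> by (intro mult_left_mono) auto
      also have "\<dots> < 2 * \<rho> z"
        using N \<open>dist c d < _\<close> by (simp add: field_simps)
      finally show ?thesis .
    qed
    then have rho: "(\<kappa> + 1) * (real n * s) < \<rho> z"
      by (simp add: N_def algebra_simps)
    have Fz: "f y \<le> F z + \<eta>" if "y \<in> ball z (\<rho> z)" for y
      using \<rho>[OF zV] that fF[of y] by fastforce
    have "\<exists>p r. support_slopes u U (A \<inter> cbox c d) \<subseteq> cball p r \<and>
      emeasure lborel (cball p r) \<le> ennreal (slope_volume lam CARD('n) * (F z + \<eta>) ^ CARD('n)) * emeasure lborel (box c d)"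
    proof (rule support_slopes_cube[OF lam super lsc _ side s])
      show "A \<subseteq> U" "ball z (\<rho> z) \<subseteq> U"
        using V \<rho>[OF zV] by blast+
      show "z \<in> cbox c d"
        using z(2) K by simp
      show "(cylinder_radius lam Lam CARD('n) + 1) * (real CARD('n) * s) < \<rho> z"
        using rho unfolding n_def \<kappa>_def .
      show "0 \<le> F z + \<eta>"
        using F0[of z] \<open>0 < \<eta>\<close> by linarith
    qed (fact Fz)
    then obtain p r where pr: "support_slopes u U (A \<inter> K) \<subseteq> cball p r"
      "emeasure lborel (cball p r) \<le> ennreal (slope_volume lam n * (F z + \<eta>) ^ n) * emeasure lborel (box c d)"
      unfolding K n_def by blast
    have "ennreal (slope_volume lam n * (F z + \<eta>) ^ n) * emeasure lborel (box c d)
        = (\<integral>\<^sup>+x. ennreal (slope_volume lam n * (F z + \<eta>) ^ n) * indicator (box c d) x \<partial>lborel)"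
      by (simp add: nn_integral_cmult_indicator)
    also have "\<dots> \<le> (\<integral>\<^sup>+x\<in>box c d. H x \<partial>lborel)"
    proof (rule nn_integral_mono)
      fix x
      show "ennreal (slope_volume lam n * (F z + \<eta>) ^ n) * indicator (box c d) x \<le> H x * indicator (box c d) x"
      proof (cases "x \<in> box c d")
        case True
        then have "x \<in> interior K" by (simp add: K interior_cbox)
        then have x: "x \<in> V" "x \<in> ball z (\<rho> z)"
          using KV K\<rho> interior_subset by blast+
        then have "F z + \<eta> \<le> F x + 2 * \<eta>"
          using \<rho>[OF zV] by fastforce
        then have "slope_volume lam n * (F z + \<eta>) ^ n \<le> h x"
          unfolding h_def using slope_volume_nonneg[OF lam(1)] F0[of z] \<open>0 < \<eta>\<close>
          by (intro mult_left_mono power_mono) auto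
        then show ?thesis
          using x True by (simp add: H_def ennreal_leI)
      qed simp
    qed
    also have "\<dots> = emeasure \<nu> (interior K)"
      unfolding \<nu>_def K interior_cbox by (simp add: emeasure_density)
    finally show ?thesis
      using pr KV order_trans by blast
  qed
  then obtain p r where pr: "\<And>K. K \<in> \<D> \<Longrightarrow> support_slopes u U (A \<inter> K) \<subseteq> cball (p K) (r K) \<and>
      interior K \<subseteq> V \<and> emeasure lborel (cball (p K) (r K)) \<le> emeasure \<nu> (interior K)"
    by metis
  define D where "D = (\<Union>K\<in>\<D>. cball (p K) (r K))"
  show ?thesis
  proof
    show "D \<in> sets lborel"
      unfolding D_def by (rule sets.countable_UN'[OF \<D>(1)]) auto
    show "support_slopes u U A \<subseteq> D"
    proof
      fix q assume "q \<in> support_slopes u U A"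
      then obtain x where x: "x \<in> A" "\<forall>y\<in>U. u x + q \<bullet> (y - x) \<le> u y"
        unfolding support_slopes_def by blast
      then obtain K where K: "K \<in> \<D>" "x \<in> K"
        using \<D>(6) by blast
      then have "q \<in> support_slopes u U (A \<inter> K)"
        using x unfolding support_slopes_def by blast
      then show "q \<in> D"
        using pr[OF K(1)] K(1) unfolding D_def by blast
    qed
    have "emeasure lborel D \<le> emeasure \<nu> (\<Union>K\<in>\<D>. interior K)"
      unfolding D_def
    proof (rule emeasure_UN_le_disjoint[OF \<D>(1)])
      show "disjoint_family_on interior \<D>"
        using \<D>(3) unfolding disjoint_family_on_def pairwise_def by blast
    qed (use pr in \<open>auto simp: \<nu>_def\<close>)
    also have "\<dots> \<le> emeasure \<nu> UNIV"
      by (rule emeasure_mono) (auto simp: \<nu>_def)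
    also have "\<dots> = (\<integral>\<^sup>+x. H x \<partial>lborel)"
      by (simp add: \<nu>_def emeasure_density)
    also have "\<dots> = (\<integral>\<^sup>+x. ennreal (slope_volume lam n) * (ennreal ((F x + 2 * \<eta>) ^ n) * indicator V x) \<partial>lborel)"
      using F0 \<open>0 < \<eta>\<close> slope_volume_nonneg[OF lam(1)]
      by (intro nn_integral_cong) (simp add: H_def h_def ennreal_mult' split: split_indicator)
    also have "\<dots> = ennreal (slope_volume lam n) * (\<integral>\<^sup>+x\<in>V. ennreal ((F x + 2 * \<eta>) ^ n) \<partial>lborel)"
    proof (rule nn_integral_cmult)
      have "continuous_on V (\<lambda>x. (F x + 2 * \<eta>) ^ n)"
        using F V(3) by (intro continuous_intros) (rule continuous_on_subset)
      then have [measurable]: "(\<lambda>x. indicator V x * (F x + 2 * \<eta>) ^ n) \<in> borel_measurable borel"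
        unfolding real_scaleR_def[symmetric] by (intro borel_measurable_continuous_on_indicator) auto
      have "(\<lambda>x. ennreal (indicator V x * (F x + 2 * \<eta>) ^ n)) \<in> borel_measurable lborel"
        by simp
      also have "(\<lambda>x. ennreal (indicator V x * (F x + 2 * \<eta>) ^ n)) = (\<lambda>x. ennreal ((F x + 2 * \<eta>) ^ n) * indicator V x)"
        by (auto split: split_indicator)
      finally show "(\<lambda>x. ennreal ((F x + 2 * \<eta>) ^ n) * indicator V x) \<in> borel_measurable lborel" .
    qed
    finally show "emeasure lborel D \<le> ennreal (slope_volume lam CARD('n)) *
       (\<integral>\<^sup>+x\<in>V. ennreal ((pos_part (f x) + 2 * \<eta>) ^ CARD('n)) \<partial>lborel)"
      by (simp add: F_def n_def)
  qed
qed

lemma add_power_le: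
  fixes x y :: real
  assumes "0 \<le> x" "0 \<le> y"
  shows "(x + y) ^ n \<le> 2 ^ n * (x ^ n + y ^ n)"
proof -
  have "(x + y) ^ n \<le> (2 * max x y) ^ n"
    using assms by (intro power_mono) auto
  also have "\<dots> = 2 ^ n * max x y ^ n"
    by (rule power_mult_distrib)
  also have "\<dots> \<le> 2 ^ n * (x ^ n + y ^ n)"
    using assms by (intro mult_left_mono) (auto simp: max_def)
  finally show ?thesis .
qed

text \<open>Outer regularity supplies an open V around A on which the integral of (F + \<delta>)^n,
  with F the positive part of f, is almost that over A. The offset \<delta> is then removed by
  splitting the power, which costs the factor 2^n, and by the finite measure of U.\<close>

lemma support_slopes_cover:
  fixes u f :: "real ^ 'n::finite \<Rightarrow> real"
  assumes lam: "0 < lam" "lam \<le> Lam"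
    and super: "pucci_supersolution (lam / real CARD('n)) Lam f U u" and lsc: "lsc_on U u"
    and U: "open U" "bounded U" and A: "A \<subseteq> U" "A \<in> sets borel"
    and f: "continuous_on U f" and "0 < \<epsilon>"
  obtains D where "D \<in> sets lborel" "support_slopes u U A \<subseteq> D"
    "emeasure lborel D \<le> ennreal (slope_volume lam CARD('n) * 2 ^ CARD('n)) *
       ((\<integral>\<^sup>+x\<in>A. ennreal (pos_part (f x) ^ CARD('n)) \<partial>lborel) + ennreal \<epsilon>)"
proof -
  define n where "n = CARD('n)"
  have n: "n \<ge> 1"
    by (simp add: n_def Suc_leI)
  define W where "W = measure lborel U"
  have UW: "emeasure lborel U = ennreal W" and W: "W \<ge> 0"
    unfolding W_def using emeasure_bounded_finite[OF U(2)] by (auto simp: emeasure_eq_ennreal_measure)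
  \<comment> \<open>The bound 1 gives \<delta>^n \<le> \<delta>. The other bound gives \<delta> W
    \<le> \<epsilon> / 2; the remaining half of \<epsilon> pays for the passage from A to V.\<close>
  define \<delta> where "\<delta> = min 1 (\<epsilon> / 2 / (W + 1))"
  have \<delta>: "0 < \<delta>" "\<delta> \<le> 1" "\<delta> * W \<le> \<epsilon> / 2"
  proof -
    have "\<delta> * W \<le> \<epsilon> / 2 / (W + 1) * (W + 1)"
      using W \<open>0 < \<epsilon>\<close> by (intro mult_mono) (auto simp: \<delta>_def)
    also have "\<dots> = \<epsilon> / 2"
    proof -
      have "W + 1 \<noteq> 0"
        using W by linarith
      then show ?thesis
        by (metis nonzero_eq_divide_eq)
    qed
    finally show "\<delta> * W \<le> \<epsilon> / 2" .
  qed (use W \<open>0 < \<epsilon>\<close> in \<open>auto simp: \<delta>_def\<close>)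
  define F where "F = (\<lambda>x. pos_part (f x))"
  have F: "continuous_on U F" and F0: "F x \<ge> 0" for x
    using f unfolding F_def pos_part_def by (auto intro!: continuous_intros)
  have cont: "continuous_on U (\<lambda>x. (F x + \<delta>) ^ n)"
    using F by (intro continuous_intros)
  obtain V where V: "open V" "A \<subseteq> V" "V \<subseteq> U"
    "(\<integral>\<^sup>+x\<in>V. ennreal ((F x + \<delta>) ^ n) \<partial>lborel) \<le> (\<integral>\<^sup>+x\<in>A. ennreal ((F x + \<delta>) ^ n) \<partial>lborel) + ennreal (\<epsilon> / 2)"
    by (rule nn_integral_outer_open[OF U(1) cont A, of "\<epsilon> / 2"]) (use \<open>0 < \<epsilon>\<close> in auto)
  obtain D where D: "D \<in> sets lborel" "support_slopes u U A \<subseteq> D"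
    "emeasure lborel D \<le> ennreal (slope_volume lam n) * (\<integral>\<^sup>+x\<in>V. ennreal ((F x + \<delta>) ^ n) \<partial>lborel)"
    using support_slopes_cover_open[OF lam super lsc V(1-3) U(2) f, of "\<delta> / 2"] \<delta>
    unfolding F_def n_def by auto
  have [measurable]: "A \<in> sets borel" by fact
  have "continuous_on A F"
    using F A continuous_on_subset by blast
  then have [measurable]: "(\<lambda>x. indicator A x * F x) \<in> borel_measurable borel"
    unfolding real_scaleR_def[symmetric] by (intro borel_measurable_continuous_on_indicator) auto
  have "(\<integral>\<^sup>+x\<in>A. ennreal ((F x + \<delta>) ^ n) \<partial>lborel)
      \<le> (\<integral>\<^sup>+x. ennreal (2 ^ n) * (ennreal ((indicator A x * F x) ^ n) + ennreal \<delta> * indicator A x) \<partial>lborel)"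
  proof (rule nn_integral_mono)
    fix x
    have "(F x + \<delta>) ^ n \<le> 2 ^ n * (F x ^ n + \<delta> ^ n)"
      using add_power_le F0 \<delta> by (simp add: less_imp_le)
    also have "\<dots> \<le> 2 ^ n * (F x ^ n + \<delta>)"
      using \<delta> n power_decreasing[of 1 n \<delta>] by simp
    finally have "ennreal ((F x + \<delta>) ^ n) \<le> ennreal (2 ^ n * (F x ^ n + \<delta>))"
      by (rule ennreal_leI)
    also have "\<dots> = ennreal (2 ^ n) * (ennreal (F x ^ n) + ennreal \<delta>)"
      using F0 \<delta> by (simp add: ennreal_mult'' ennreal_plus[symmetric] del: ennreal_plus)
    finally show "ennreal ((F x + \<delta>) ^ n) * indicator A x
        \<le> ennreal (2 ^ n) * (ennreal ((indicator A x * F x) ^ n) + ennreal \<delta> * indicator A x)"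
      by (auto split: split_indicator)
  qed
  also have "\<dots> = ennreal (2 ^ n) *
      ((\<integral>\<^sup>+x. ennreal ((indicator A x * F x) ^ n) \<partial>lborel) + ennreal \<delta> * emeasure lborel A)"
    by (simp add: nn_integral_cmult nn_integral_add nn_integral_cmult_indicator)
  also have "(\<integral>\<^sup>+x. ennreal ((indicator A x * F x) ^ n) \<partial>lborel) = (\<integral>\<^sup>+x\<in>A. ennreal (F x ^ n) \<partial>lborel)"
    using n by (intro nn_integral_cong) (auto simp: zero_power split: split_indicator)
  finally have "(\<integral>\<^sup>+x\<in>A. ennreal ((F x + \<delta>) ^ n) \<partial>lborel)
      \<le> ennreal (2 ^ n) * ((\<integral>\<^sup>+x\<in>A. ennreal (F x ^ n) \<partial>lborel) + ennreal \<delta> * emeasure lborel A)" .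
  also have "ennreal \<delta> * emeasure lborel A \<le> ennreal \<delta> * emeasure lborel U"
    using A U by (intro mult_left_mono emeasure_mono) auto
  also have "ennreal \<delta> * emeasure lborel U \<le> ennreal (\<epsilon> / 2)"
    unfolding UW using \<delta> W by (simp add: ennreal_mult'[symmetric] ennreal_leI)
  finally have IA: "(\<integral>\<^sup>+x\<in>A. ennreal ((F x + \<delta>) ^ n) \<partial>lborel)
      \<le> ennreal (2 ^ n) * ((\<integral>\<^sup>+x\<in>A. ennreal (F x ^ n) \<partial>lborel) + ennreal (\<epsilon> / 2))"
    by (simp add: mult_left_mono add_left_mono)
  have "ennreal (\<epsilon> / 2) \<le> ennreal (2 ^ n) * ennreal (\<epsilon> / 2)"
    using \<open>0 < \<epsilon>\<close> by (simp add: ennreal_mult'[symmetric] ennreal_leI)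
  then have "(\<integral>\<^sup>+x\<in>V. ennreal ((F x + \<delta>) ^ n) \<partial>lborel)
      \<le> ennreal (2 ^ n) * ((\<integral>\<^sup>+x\<in>A. ennreal (F x ^ n) \<partial>lborel) + ennreal (\<epsilon> / 2))
        + ennreal (2 ^ n) * ennreal (\<epsilon> / 2)"
    using V(4) IA by (meson add_mono order_trans)
  also have "\<dots> = ennreal (2 ^ n) * ((\<integral>\<^sup>+x\<in>A. ennreal (F x ^ n) \<partial>lborel) + (ennreal (\<epsilon> / 2) + ennreal (\<epsilon> / 2)))"
    by (simp only: distrib_left add.assoc)
  also have "ennreal (\<epsilon> / 2) + ennreal (\<epsilon> / 2) = ennreal \<epsilon>"
    using \<open>0 < \<epsilon>\<close> by (subst ennreal_plus[symmetric]) auto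
  finally have "emeasure lborel D \<le> ennreal (slope_volume lam n) *
      (ennreal (2 ^ n) * ((\<integral>\<^sup>+x\<in>A. ennreal (F x ^ n) \<partial>lborel) + ennreal \<epsilon>))"
    using D(3) by (meson mult_left_mono order_trans zero_le)
  also have "\<dots> = ennreal (slope_volume lam n * 2 ^ n) * ((\<integral>\<^sup>+x\<in>A. ennreal (F x ^ n) \<partial>lborel) + ennreal \<epsilon>)"
    using slope_volume_nonneg[OF lam(1)] by (simp add: ennreal_mult'' mult.assoc)
  finally show ?thesis
    using that[OF D(1,2)] by (simp add: n_def F_def)
qed

section \<open>The interface\<close>

text \<open>The preimage of W contains a product of intervals of half-length \<rho> / (2 n) around
  the coordinates of x. For n = 1 the product is over the empty index set and has measure 1.\<close>

lemma emeasure_hyperplane_measure_pos: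
  fixes x :: "real ^ 'n::finite"
  assumes "open W" "x \<in> W" "x $ k = 0"
  shows "0 < emeasure (hyperplane_measure k) (W \<inter> {y. y $ k = 0})"
proof -
  define I where "I = (UNIV :: 'n set) - {k}"
  let ?P = "Pi\<^sub>M I (\<lambda>_. lborel :: real measure)"
  let ?e = "\<lambda>y. (\<chi> i. if i = k then 0 else y i) :: real ^ 'n"
  interpret product_sigma_finite "\<lambda>_ :: 'n. lborel :: real measure" ..
  have e[measurable]: "?e \<in> borel_measurable ?P"
  proof (subst borel_measurable_euclidean_space, intro ballI)
    fix b :: "real ^ 'n" assume "b \<in> Basis"
    then obtain j where b: "b = axis j 1"
      by (auto simp: Basis_vec_def)
    show "(\<lambda>y. ?e y \<bullet> b) \<in> borel_measurable ?P"
    proof (cases "j = k")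
      case False
      then have "j \<in> I" by (simp add: I_def)
      then have "(\<lambda>y. y j) \<in> borel_measurable ?P"
        using measurable_component_singleton[of j I "\<lambda>_. lborel"] by simp
      then show ?thesis using False by (simp add: b inner_axis)
    qed (simp add: b inner_axis)
  qed
  obtain \<rho> where \<rho>: "\<rho> > 0" "ball x \<rho> \<subseteq> W"
    using assms openE by blast
  define r where "r = \<rho> / (2 * real CARD('n))"
  have r: "r > 0"
    using \<rho> by (simp add: r_def)
  have "closed {y :: real ^ 'n. y $ k = 0}"
    by (intro closed_Collect_eq continuous_intros)
  then have W[measurable]: "W \<inter> {y. y $ k = 0} \<in> sets borel"
    using assms(1) by (intro sets.Int borel_open borel_closed)
  let ?B = "Pi\<^sub>E I (\<lambda>i. {x $ i - r<..<x $ i + r})"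
  have sub: "?B \<subseteq> ?e -` (W \<inter> {y. y $ k = 0}) \<inter> space ?P"
  proof
    fix y assume y: "y \<in> ?B"
    have "\<bar>(?e y - x) $ i\<bar> \<le> r" for i
    proof (cases "i = k")
      case True
      then show ?thesis using assms(3) r by simp
    next
      case False
      then have "y i \<in> {x $ i - r<..<x $ i + r}"
        using PiE_mem[OF y, of i] by (simp add: I_def)
      then have "\<bar>y i - x $ i\<bar> \<le> r"
        by (simp add: abs_le_iff)
      then show ?thesis using False by simp
    qed
    then have "(\<Sum>i\<in>UNIV. \<bar>(?e y - x) $ i\<bar>) \<le> (\<Sum>i\<in>(UNIV :: 'n set). r)"
      by (intro sum_mono)
    then have "norm (?e y - x) \<le> real CARD('n) * r"
      using norm_le_l1_cart[of "?e y - x"] by simp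
    also have "\<dots> < \<rho>"
      using \<rho> by (simp add: r_def)
    finally have "?e y \<in> W"
      using \<rho>(2) by (metis dist_commute dist_norm mem_ball subsetD)
    moreover have "y \<in> space ?P"
      using y by (simp add: space_PiM PiE_iff)
    ultimately show "y \<in> ?e -` (W \<inter> {y. y $ k = 0}) \<inter> space ?P"
      by simp
  qed
  have "emeasure ?P ?B = (\<Prod>i\<in>I. emeasure lborel {x $ i - r<..<x $ i + r})"
    by (rule emeasure_PiM) auto
  also have "\<dots> = ennreal ((2 * r) ^ card I)"
    using r by (simp add: ennreal_power)
  finally have "0 < emeasure ?P ?B"
    using r by simp
  also have "\<dots> \<le> emeasure ?P (?e -` (W \<inter> {y. y $ k = 0}) \<inter> space ?P)"
    by (rule emeasure_mono[OF sub]) (use measurable_sets[OF e W] in simp)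
  also have "\<dots> = emeasure (hyperplane_measure k) (W \<inter> {y. y $ k = 0})"
    unfolding hyperplane_measure_def I_def[symmetric] by (rule emeasure_distr[symmetric]) auto
  finally show ?thesis .
qed

text \<open>By continuity an excess over the essential supremum at x would persist on a relatively
  open part of the interface, which has positive measure. Thus contact at a single interface point
  can be charged to the norm of g.\<close>

lemma Linf_norm_interface_ge:
  fixes h :: "real ^ 'n::finite \<Rightarrow> real"
  assumes "open \<Omega>" "continuous_on (interface k \<Omega>) h" "x \<in> interface k \<Omega>"
  shows "ennreal \<bar>h x\<bar> \<le> Linf_norm (hyperplane_measure k) (interface k \<Omega>) h"
proof (rule ccontr)
  let ?T = "interface k \<Omega>" and ?H = "hyperplane_measure k"
  let ?f = "\<lambda>y. ennreal \<bar>h y\<bar>"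
  define E where "E = Linf_norm ?H ?T h"
  assume "\<not> ennreal \<bar>h x\<bar> \<le> Linf_norm ?H ?T h"
  then have less: "E < ?f x"
    by (simp add: E_def)
  have AE: "AE y in restrict_space ?H ?T. ?f y \<le> E"
    unfolding E_def Linf_norm_def by (intro esssup_AE)
  have setsH: "sets ?H = sets borel" and spaceH: "space ?H = UNIV"
    by (auto simp: hyperplane_measure_def)
  have "closed {y :: real ^ 'n. y $ k = 0}"
    by (intro closed_Collect_eq continuous_intros)
  then have T: "?T \<in> sets borel"
    using assms(1) unfolding interface_def by (intro sets.Int borel_open borel_closed)
  have "continuous_on ?T ?f"
    using assms(2) by (intro continuous_on_ennreal continuous_intros)
  then have "(?f \<longlongrightarrow> ?f x) (at x within ?T)"
    using assms(3) by (simp add: continuous_on_def)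
  then have "\<forall>\<^sub>F y in at x within ?T. E < ?f y"
    using less by (rule order_tendstoD)
  then obtain V where V: "open V" "x \<in> V" "\<And>y. y \<in> V \<Longrightarrow> y \<noteq> x \<Longrightarrow> y \<in> ?T \<Longrightarrow> E < ?f y"
    unfolding eventually_at_topological by blast
  define W where "W = V \<inter> \<Omega>"
  have W: "open W" "x \<in> W" "x $ k = 0"
    using V assms by (auto simp: W_def interface_def)
  have "AE y in ?H. y \<in> ?T \<longrightarrow> ?f y \<le> E"
    using AE T by (subst (asm) AE_restrict_space_iff) (auto simp: setsH spaceH)
  then have "AE y in ?H. y \<notin> W \<inter> {y. y $ k = 0}"
  proof eventually_elim
    case (elim y)
    show ?case
    proof
      assume y: "y \<in> W \<inter> {y. y $ k = 0}"
      then have "y \<in> ?T" "y \<in> V"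
        by (auto simp: W_def interface_def)
      then have "E < ?f y"
        using V(3) less by blast
      then show False
        using elim \<open>y \<in> ?T\<close> by simp
    qed
  qed
  moreover have "W \<inter> {y. y $ k = 0} \<in> sets ?H"
    using \<open>closed {y. y $ k = 0}\<close> W unfolding setsH by (intro sets.Int borel_open borel_closed)
  ultimately have "emeasure ?H (W \<inter> {y. y $ k = 0}) = 0"
    using AE_iff_measurable[of "W \<inter> {y. y $ k = 0}" ?H "\<lambda>y. y \<notin> W \<inter> {y. y $ k = 0}"]
    by (auto simp: spaceH)
  then show False
    using emeasure_hyperplane_measure_pos[OF W] by simp
qed

text \<open>Regrouped, the expression is (K \<gamma>p_k + \<gamma>p \<bullet> p) + \<theta> (K
  \<gamma>m_k - \<gamma>m \<bullet> p). For small p each bracket is at least \<lambda> K / 2; of the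
  second term only its sign is kept, which makes the bound uniform in \<theta>.\<close>

lemma transmission_min_ge:
  fixes p :: "real ^ 'n::finite"
  assumes "0 < lam" "lam \<le> Lam" "0 \<le> mu" "0 \<le> \<theta>" "norm p \<le> K"
    and small: "(lam + 2 * mu) * norm p \<le> lam * K / 2"
  shows "lam * K / 2 \<le> transmission_min k (p + K *\<^sub>R axis k 1) (\<theta> *\<^sub>R (p - K *\<^sub>R axis k 1)) lam Lam mu"
  unfolding transmission_min_def
proof (rule cInf_greatest)
  have "lam *\<^sub>R axis k 1 \<in> oblique_set k lam Lam mu"
  proof -
    have "tangential k (lam *\<^sub>R axis k 1) = 0"
      by (simp add: tangential_def vec_eq_iff axis_def)
    then show ?thesis
      using assms by (simp add: oblique_set_def)
  qed
  then show "{\<gamma>p \<bullet> (p + K *\<^sub>R axis k 1) - \<gamma>m \<bullet> (\<theta> *\<^sub>R (p - K *\<^sub>R axis k 1)) |\<gamma>p \<gamma>m.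
      \<gamma>p \<in> oblique_set k lam Lam mu \<and> \<gamma>m \<in> oblique_set k lam Lam mu} \<noteq> {}"
    by blast
next
  \<comment> \<open>Splitting \<gamma> into its normal and tangential parts bounds the right-hand
    side below by \<lambda> (K - |p|) - \<mu> |p|.\<close>
  have half: "lam * K / 2 \<le> K * \<gamma> $ k - \<bar>\<gamma> \<bullet> p\<bar>" if "\<gamma> \<in> oblique_set k lam Lam mu" for \<gamma>
  proof -
    have \<gamma>: "lam \<le> \<gamma> $ k" "norm (tangential k \<gamma>) \<le> mu"
      using that by (auto simp: oblique_set_def)
    have "\<gamma> = \<gamma> $ k *\<^sub>R axis k 1 + tangential k \<gamma>"
      by (simp add: vec_eq_iff tangential_def axis_def)
    then have "\<gamma> \<bullet> p = \<gamma> $ k * p $ k + tangential k \<gamma> \<bullet> p"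
      by (metis inner_add_left inner_axis' inner_real_def inner_scaleR_left mult_1)
    moreover have "\<bar>\<gamma> $ k * p $ k\<bar> \<le> \<gamma> $ k * norm p"
      using \<gamma> assms component_le_norm_cart[of p k] by (simp add: abs_mult mult_left_mono)
    moreover have "\<bar>tangential k \<gamma> \<bullet> p\<bar> \<le> mu * norm p"
      using Cauchy_Schwarz_ineq2[of "tangential k \<gamma>" p] mult_right_mono[OF \<gamma>(2), of "norm p"] by simp
    moreover have "lam * (K - norm p) \<le> \<gamma> $ k * (K - norm p)"
      using \<gamma> assms by (intro mult_right_mono) auto
    moreover have "0 \<le> mu * norm p"
      using assms by simp
    ultimately show ?thesis
      using small by (simp add: algebra_simps)
  qed
  have nonneg: "0 \<le> lam * K / 2"
    using assms norm_ge_zero[of p] by (simp del: norm_ge_zero)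
  fix t assume "t \<in> {\<gamma>p \<bullet> (p + K *\<^sub>R axis k 1) - \<gamma>m \<bullet> (\<theta> *\<^sub>R (p - K *\<^sub>R axis k 1)) |\<gamma>p \<gamma>m.
      \<gamma>p \<in> oblique_set k lam Lam mu \<and> \<gamma>m \<in> oblique_set k lam Lam mu}"
  then obtain \<gamma>p \<gamma>m where \<gamma>: "\<gamma>p \<in> oblique_set k lam Lam mu" "\<gamma>m \<in> oblique_set k lam Lam mu"
    and t: "t = \<gamma>p \<bullet> (p + K *\<^sub>R axis k 1) - \<gamma>m \<bullet> (\<theta> *\<^sub>R (p - K *\<^sub>R axis k 1))"
    by blast
  have "t = (K * \<gamma>p $ k + \<gamma>p \<bullet> p) + \<theta> * (K * \<gamma>m $ k - \<gamma>m \<bullet> p)"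
    by (simp add: t inner_add_right inner_diff_right inner_axis algebra_simps)
  moreover have "0 \<le> \<theta> * (K * \<gamma>m $ k - \<gamma>m \<bullet> p)"
    using half[OF \<gamma>(2)] nonneg assms by (intro mult_nonneg_nonneg) linarith+
  ultimately show "lam * K / 2 \<le> t"
    using half[OF \<gamma>(1)] by linarith
qed

section \<open>The contact set\<close>

lemma lsc_on_neg_part: "lsc_on S u \<Longrightarrow> lsc_on S (\<lambda>x. - neg_part (u x))"
  unfolding lsc_on_def
proof (intro ballI allI impI)
  fix x c assume *: "\<forall>x\<in>S. \<forall>c<u x. \<forall>\<^sub>F y in at x within S. c < u y"
    and "x \<in> S" "c < - neg_part (u x)"
  then have "\<forall>\<^sub>F y in at x within S. c < u y" and "c < 0"
    by (auto simp: neg_part_def)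
  then show "\<forall>\<^sub>F y in at x within S. c < - neg_part (u y)"
    by (auto simp: neg_part_def elim!: eventually_mono)
qed

abbreviation truncation :: "real \<Rightarrow> (real ^ 'n::finite \<Rightarrow> real) \<Rightarrow> real ^ 'n \<Rightarrow> real" where
  "truncation R u y \<equiv> - neg_part (u y) * indicator (ball 0 R) y"

text \<open>The affine minorant is there to make the set of values nonempty, since the real
  \<open>Sup\<close> of the empty set is unspecified.\<close>

lemma convex_envelope_le:
  assumes "\<forall>y\<in>ball 0 (2 * R). a \<bullet> y + b \<le> truncation R u y" "x \<in> ball 0 (2 * R)"
  shows "convex_envelope R u x \<le> truncation R u x"
  unfolding convex_envelope_def by (rule cSup_least) (use assms in blast)+

lemma affine_le_convex_envelope:
  assumes "\<forall>y\<in>ball 0 (2 * R). a \<bullet> y + b \<le> truncation R u y" "x \<in> ball 0 (2 * R)"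
  shows "a \<bullet> x + b \<le> convex_envelope R u x"
  unfolding convex_envelope_def
proof (rule cSup_upper)
  show "bdd_above {a \<bullet> x + b |a b. \<forall>y\<in>ball 0 (2 * R). a \<bullet> y + b \<le> truncation R u y}"
    by (rule bdd_aboveI[of _ "truncation R u x"]) (use assms(2) in blast)
qed (use assms in blast)

lemma continuous_on_convex_envelope:
  assumes minorant: "\<forall>y\<in>ball 0 (2 * R). a0 \<bullet> y + b0 \<le> truncation R u y"
  shows "continuous_on (ball 0 (2 * R)) (convex_envelope R u)"
proof (rule convex_on_continuous[OF open_ball])
  show "convex_on (ball 0 (2 * R)) (convex_envelope R u)"
  proof (rule convex_onI)
    fix t :: real and x y :: "real ^ 'a"
    assume t: "0 < t" "t < 1" and xy: "x \<in> ball 0 (2 * R)" "y \<in> ball 0 (2 * R)"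
    show "convex_envelope R u ((1 - t) *\<^sub>R x + t *\<^sub>R y)
        \<le> (1 - t) * convex_envelope R u x + t * convex_envelope R u y"
      unfolding convex_envelope_def[of R u "(1 - t) *\<^sub>R x + t *\<^sub>R y"]
    proof (rule cSup_least)
      fix z assume "z \<in> {a \<bullet> ((1 - t) *\<^sub>R x + t *\<^sub>R y) + b |a b.
          \<forall>y\<in>ball 0 (2 * R). a \<bullet> y + b \<le> truncation R u y}"
      then obtain a b where z: "z = a \<bullet> ((1 - t) *\<^sub>R x + t *\<^sub>R y) + b"
        and ab: "\<forall>y\<in>ball 0 (2 * R). a \<bullet> y + b \<le> truncation R u y"
        by blast
      have "z = (1 - t) * (a \<bullet> x + b) + t * (a \<bullet> y + b)"
        by (simp add: z inner_add_right algebra_simps)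
      also have "\<dots> \<le> (1 - t) * convex_envelope R u x + t * convex_envelope R u y"
        using affine_le_convex_envelope[OF ab] xy t by (intro add_mono mult_left_mono) auto
      finally show "z \<le> (1 - t) * convex_envelope R u x + t * convex_envelope R u y" .
    qed (use minorant in blast)
  qed simp
qed

text \<open>Inside the ball the envelope is at most u, so the contact set is the ball without the
  set where the envelope is strictly smaller. That set is open: the envelope is convex, hence
  continuous, and its difference from u is lower semicontinuous.\<close>

lemma contact_set_borel:
  assumes "0 < R" and lsc: "lsc_on (ball 0 R) u"
    and minorant: "\<forall>y\<in>ball 0 (2 * R). a0 \<bullet> y + b0 \<le> truncation R u y"
  shows "ball 0 R \<inter> {x. u x = convex_envelope R u x} \<in> sets borel"
proof -
  let ?\<Gamma> = "convex_envelope R u"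
  let ?N = "ball 0 R \<inter> {x. ?\<Gamma> x < u x}"
  have sub: "ball 0 R \<subseteq> (ball 0 (2 * R) :: (real ^ 'a) set)"
    using \<open>0 < R\<close> by auto
  have \<Gamma>: "continuous_on (ball 0 R) ?\<Gamma>"
    using continuous_on_convex_envelope[OF minorant] sub by (rule continuous_on_subset)
  have "?\<Gamma> x \<le> u x" if "x \<in> ball 0 R" for x
    using convex_envelope_le[OF minorant, of x] that sub by (fastforce simp: neg_part_def)
  then have eq: "ball 0 R \<inter> {x. u x = ?\<Gamma> x} = ball 0 R - ?N"
    by force
  have "open ?N"
    unfolding open_subopen[of ?N]
  proof
    fix x assume x: "x \<in> ?N"
    have "lsc_on (ball 0 R) (\<lambda>y. u y + - ?\<Gamma> y)"
      using lsc \<Gamma> by (intro lsc_on_add_continuous continuous_intros)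
    moreover have "0 < u x + - ?\<Gamma> x"
      using x by simp
    ultimately have "\<forall>\<^sub>F y in at x within ball 0 R. 0 < u y + - ?\<Gamma> y"
      using x unfolding lsc_on_def by blast
    then obtain V where V: "open V" "x \<in> V" "\<And>y. y \<in> V \<Longrightarrow> y \<noteq> x \<Longrightarrow> y \<in> ball 0 R \<Longrightarrow> 0 < u y + - ?\<Gamma> y"
      unfolding eventually_at_topological by blast
    have "V \<inter> ball 0 R \<subseteq> ?N"
    proof
      fix y assume "y \<in> V \<inter> ball 0 R"
      then show "y \<in> ?N"
        using V(3)[of y] x by (cases "y = x") auto
    qed
    then show "\<exists>T. open T \<and> x \<in> T \<and> T \<subseteq> ?N"
      using V x by (intro exI[of _ "V \<inter> ball 0 R"]) auto
  qed
  then show ?thesis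
    unfolding eq by auto
qed

text \<open>The excess m beats the oscillation of the wedge q. With L = K + |p|, the values of q at
  x0 and at the minimiser x cost R L each, which keeps x off the sphere. Between radius R and 2 R
  the translated wedge is at most -s - m + R L + 2 R L, hence below the truncation, which vanishes
  there; this is the origin of the factor 3.\<close>

lemma wedge_contact_point:
  fixes u :: "real ^ 'n::finite \<Rightarrow> real"
  assumes "0 < R" and lsc: "lsc_on (cball 0 R) u"
    and s: "0 \<le> s" "\<And>x. x \<in> sphere 0 R \<Longrightarrow> neg_part (u x) \<le> s"
    and x0: "x0 \<in> ball 0 R" "s + m \<le> neg_part (u x0)"
    and K: "0 \<le> K" "3 * R * (K + norm p) < m"
  obtains x where "x \<in> ball 0 R" "u x < 0"
    "\<And>y. y \<in> ball 0 (2 * R) \<Longrightarrow> u x + p \<bullet> (y - x) + K * (\<bar>y $ k\<bar> - \<bar>x $ k\<bar>) \<le> truncation R u y"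
proof -
  define q where "q = (\<lambda>y :: real ^ 'n. p \<bullet> y + K * \<bar>y $ k\<bar>)"
  define L where "L = K + norm p"
  have L: "0 \<le> L" "3 * (R * L) < m"
    using K by (auto simp: L_def mult.assoc)
  have q: "\<bar>q y\<bar> \<le> L * norm y" for y
  proof -
    have "\<bar>q y\<bar> \<le> \<bar>p \<bullet> y\<bar> + K * \<bar>y $ k\<bar>"
      unfolding q_def using K by (intro order_trans[OF abs_triangle_ineq]) (simp add: abs_mult)
    also have "\<dots> \<le> norm p * norm y + K * norm y"
      using K Cauchy_Schwarz_ineq2 component_le_norm_cart by (intro add_mono mult_left_mono)
    finally show ?thesis
      by (simp add: L_def algebra_simps)
  qed
  have qR: "\<bar>q y\<bar> \<le> R * L" if "norm y \<le> R" for y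
    using q[of y] mult_left_mono[OF that L(1)] by (simp add: mult.commute)
  have "lsc_on (cball 0 R) (\<lambda>y. - neg_part (u y) + - q y)"
    unfolding q_def by (intro lsc_on_add_continuous lsc_on_neg_part lsc continuous_intros)
  then have "\<exists>x\<in>cball 0 R. \<forall>y\<in>cball 0 R. - neg_part (u x) + - q x \<le> - neg_part (u y) + - q y"
    using \<open>0 < R\<close> by (intro lsc_on_attains_inf) auto
  then obtain x where x: "x \<in> cball 0 R"
    and min: "\<And>y. y \<in> cball 0 R \<Longrightarrow> - neg_part (u x) - q x \<le> - neg_part (u y) - q y"
    by auto
  have "norm x0 \<le> R" "norm x \<le> R"
    using x0 x by auto
  have ux: "- neg_part (u x) - q x \<le> - s - m + R * L"
    using min[of x0] qR[OF \<open>norm x0 \<le> R\<close>] x0 \<open>norm x0 \<le> R\<close> by auto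
  have neg: "- neg_part (u x) < - s"
    using ux qR[OF \<open>norm x \<le> R\<close>] L mult_nonneg_nonneg[of R L] \<open>0 < R\<close> by linarith
  have "x \<notin> sphere 0 R"
    using neg s(2)[of x] by auto
  then have xB: "x \<in> ball 0 R"
    using x by auto
  have u_neg: "u x < 0" and ux_eq: "- neg_part (u x) = u x"
    using neg s(1) by (auto simp: neg_part_def split: if_splits)
  have "u x + p \<bullet> (y - x) + K * (\<bar>y $ k\<bar> - \<bar>x $ k\<bar>) \<le> truncation R u y" if y: "y \<in> ball 0 (2 * R)" for y
  proof -
    have eq: "u x + p \<bullet> (y - x) + K * (\<bar>y $ k\<bar> - \<bar>x $ k\<bar>) = - neg_part (u x) - q x + q y"
      unfolding ux_eq q_def by (simp add: inner_diff_right algebra_simps)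
    show ?thesis
    proof (cases "y \<in> ball 0 R")
      case True
      then show ?thesis
        using min[of y] by (simp add: eq)
    next
      case False
      have "L * norm y \<le> L * (2 * R)"
        using L y by (intro mult_left_mono) auto
      then have "q y \<le> 2 * (R * L)"
        using q[of y] by (simp add: algebra_simps)
      then have "- neg_part (u x) - q x + q y \<le> 0"
        using ux s(1) L by linarith
      then show ?thesis
        using False by (simp add: eq)
    qed
  qed
  then show ?thesis
    using that xB u_neg by blast
qed

text \<open>The wedge has slope p + v in one phase and p - v in the other. Translation invariance
  lets both slope sets count against one set of parameters p.\<close>

lemma emeasure_ball_le_translates:
  fixes v :: "'a::euclidean_space"
  assumes "D1 \<in> sets lborel" "D2 \<in> sets lborel"
    and "\<And>p. p \<in> B \<Longrightarrow> p + v \<in> D1 \<or> p - v \<in> D2"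
  shows "emeasure lborel B \<le> emeasure lborel D1 + emeasure lborel D2"
proof -
  have tr: "emeasure lborel ((+) w -` D) = emeasure lborel D" "(+) w -` D \<in> sets lborel"
    if "D \<in> sets lborel" for w and D :: "'a set"
  proof -
    have [measurable]: "(+) w \<in> borel_measurable borel" by simp
    have D: "D \<in> sets borel" using that by simp
    have "emeasure lborel D = emeasure (distr lborel borel ((+) w)) D"
      by (simp add: lborel_distr_plus)
    also have "\<dots> = emeasure lborel ((+) w -` D)"
      using D by (subst emeasure_distr) auto
    finally show "emeasure lborel ((+) w -` D) = emeasure lborel D" ..
    show "(+) w -` D \<in> sets lborel"
      using measurable_sets[of "(+) w" borel borel D] D by simp
  qed
  have "B \<subseteq> (+) v -` D1 \<union> (+) (- v) -` D2"
  proof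
    fix p assume "p \<in> B"
    then show "p \<in> (+) v -` D1 \<union> (+) (- v) -` D2"
      using assms(3)[of p] by (auto simp: algebra_simps)
  qed
  then have "emeasure lborel B \<le> emeasure lborel ((+) v -` D1 \<union> (+) (- v) -` D2)"
    using tr(2)[OF assms(1)] tr(2)[OF assms(2)] by (intro emeasure_mono sets.Un)
  also have "\<dots> \<le> emeasure lborel ((+) v -` D1) + emeasure lborel ((+) (- v) -` D2)"
    using tr(2)[OF assms(1)] tr(2)[OF assms(2)] by (rule emeasure_subadditive)
  finally show ?thesis
    using tr(1) assms(1,2) by simp
qed

section \<open>The maximum principle\<close>

lemma S_upper_pucci_supersolution:
  fixes u :: "real ^ 'n::finite \<Rightarrow> real"
  assumes "u \<in> S_upper k lam Lam mu \<theta> fp fm g \<Omega>" "open \<Omega>"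
  shows "pucci_supersolution (lam / real CARD('n)) Lam fp (upper_part k \<Omega>) u"
    and "pucci_supersolution (lam / real CARD('n)) Lam fm (lower_part k \<Omega>) u"
  unfolding pucci_supersolution_def
  using S_upper_upper_part[OF assms] S_upper_lower_part[OF assms] by blast+

lemma add_power_superadditive:
  fixes a b :: real
  assumes "0 \<le> a" "0 \<le> b" "0 < n"
  shows "a ^ n + b ^ n \<le> (a + b) ^ n"
  using \<open>0 < n\<close>
proof (induction n rule: nat_induct_non_zero)
  case (Suc n)
  have "a ^ Suc n + b ^ Suc n \<le> (a + b) * (a ^ n + b ^ n)"
    using assms by (simp add: algebra_simps)
  also have "\<dots> \<le> (a + b) * (a + b) ^ n"
    using Suc assms by (intro mult_left_mono) auto
  finally show ?case by simp
qed simp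

text \<open>The hypothesis on g negates what interface contact would give: \<lambda> K / 2 \<le> g x
  with K = m / (12 R), that is m \<le> 24 R g x / \<lambda>. All contact is thus forced into the
  open phases. The constant 768 is 24 times 32: 24 R (\<lambda> + 2 \<mu>) / \<lambda> is 12 R /
  \<delta>, and 32 n^2 / \<lambda> is the slope constant 16 n^2 / \<lambda> doubled by the factor
  2^n of the covering.\<close>

lemma transmission_abp:
  fixes u :: "real ^ 'n::finite \<Rightarrow> real"
  assumes lam: "0 < lam" "lam \<le> Lam" "0 \<le> mu" and "0 < R" and \<theta>: "0 \<le> \<theta>"
    and fp: "continuous_on (upper_part k (ball 0 R)) fp"
    and fm: "continuous_on (lower_part k (ball 0 R)) fm"
    and u: "u \<in> S_upper k lam Lam mu \<theta> fp fm g (ball 0 R)"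
    and lsc: "lsc_on (cball 0 R) u"
    and s: "0 \<le> s" "\<And>x. x \<in> sphere 0 R \<Longrightarrow> neg_part (u x) \<le> s"
    and x0: "x0 \<in> ball 0 R" "s + m \<le> neg_part (u x0)" and "0 < m"
    and Ip: "(\<integral>\<^sup>+x\<in>{x. u x = convex_envelope R u x} \<inter> upper_part k (ball 0 R).
        ennreal (pos_part (fp x) ^ CARD('n)) \<partial>lborel) = ennreal (a ^ CARD('n))" "0 \<le> a"
    and Im: "(\<integral>\<^sup>+x\<in>{x. u x = convex_envelope R u x} \<inter> lower_part k (ball 0 R).
        ennreal (pos_part (fm x) ^ CARD('n)) \<partial>lborel) = ennreal (b ^ CARD('n))" "0 \<le> b"
    and g: "\<And>x. x \<in> interface k (ball 0 R) \<Longrightarrow> 24 * R / lam * g x < m"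
  shows "m \<le> 768 * (real CARD('n))\<^sup>2 * (lam + 2 * mu) / lam\<^sup>2 * R * (a + b)"
proof -
  define n where "n = CARD('n)"
  define B where "B = (ball 0 R :: (real ^ 'n) set)"
  define e where "e = (axis k 1 :: real ^ 'n)"
  \<comment> \<open>For |p| < \<delta> K \<le> K this gives 3 R (K + |p|) < 6 R K = m / 2, as the
    contact lemma requires. The value of \<delta> is the one for which (\<lambda> + 2 \<mu>)
    \<delta> K = \<lambda> K / 2.\<close>
  define K where "K = m / (12 * R)"
  define \<delta> where "\<delta> = lam / (2 * (lam + 2 * mu))"
  define \<omega> where "\<omega> = unit_ball_vol (real n)"
  define C where "C = slope_volume lam n * 2 ^ n"
  let ?A = "{x. u x = convex_envelope R u x}"
  have n: "n > 0"
    by (simp add: n_def)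
  have K: "K > 0" and mK: "m = 12 * R * K"
    using \<open>0 < m\<close> \<open>0 < R\<close> by (auto simp: K_def)
  have \<delta>: "0 < \<delta>" "\<delta> \<le> 1" and \<delta>_eq: "(lam + 2 * mu) * \<delta> = lam / 2"
    using lam by (auto simp: \<delta>_def field_simps)
  have \<omega>: "\<omega> > 0"
    by (simp add: \<omega>_def)
  have contact: "\<exists>x\<in>B. x $ k \<noteq> 0 \<and> u x = convex_envelope R u x \<and>
      (\<forall>y\<in>B. u x + p \<bullet> (y - x) + K * (\<bar>y $ k\<bar> - \<bar>x $ k\<bar>) \<le> u y)"
    if p: "norm p < \<delta> * K" for p
  proof -
    have pK: "norm p < K"
      using p K mult_right_mono[OF \<delta>(2), of K] by linarith
    have "3 * R * (K + norm p) < 3 * R * (2 * K)"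
      using pK \<open>0 < R\<close> by (intro mult_strict_left_mono) auto
    also have "\<dots> \<le> m"
      using K \<open>0 < R\<close> by (simp add: mK)
    finally have "3 * R * (K + norm p) < m" .
    then obtain x where x: "x \<in> ball 0 R" "u x < 0"
      and min: "\<And>y. y \<in> ball 0 (2 * R) \<Longrightarrow>
        u x + p \<bullet> (y - x) + K * (\<bar>y $ k\<bar> - \<bar>x $ k\<bar>) \<le> truncation R u y"
      using wedge_contact_point[OF \<open>0 < R\<close> lsc s x0] K by (metis less_imp_le)
    have ux: "truncation R u x = u x"
      using x by (simp add: neg_part_def)
    have support: "u x + p \<bullet> (y - x) + K * (\<bar>y $ k\<bar> - \<bar>x $ k\<bar>) \<le> u y" if "y \<in> B" for y
    proof -
      have "truncation R u y \<le> u y"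
        using that by (simp add: B_def neg_part_def)
      then show ?thesis
        using min[of y] that \<open>0 < R\<close> by (simp add: B_def)
    qed
    have "u x = convex_envelope R u x"
    proof -
      \<comment> \<open>A subgradient of the absolute value at x_k, with \<open>sgn 0 = 0\<close> on
        the interface. It replaces the wedge by an affine function lying below it and equal to it at
        x, which is a competitor in the envelope.\<close>
      define \<sigma> where "\<sigma> = sgn (x $ k)"
      have \<sigma>: "\<sigma> * (t - x $ k) \<le> \<bar>t\<bar> - \<bar>x $ k\<bar>" for t
        unfolding \<sigma>_def by (auto simp: sgn_if)
      define v where "v = p + (K * \<sigma>) *\<^sub>R e"
      have "v \<bullet> y + (u x - v \<bullet> x) \<le> truncation R u y" if "y \<in> ball 0 (2 * R)" for y
      proof -
        have "v \<bullet> y + (u x - v \<bullet> x) = u x + p \<bullet> (y - x) + K * (\<sigma> * (y $ k - x $ k))"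
          by (simp add: v_def e_def inner_add_left inner_diff_right inner_axis' algebra_simps)
        also have "\<dots> \<le> u x + p \<bullet> (y - x) + K * (\<bar>y $ k\<bar> - \<bar>x $ k\<bar>)"
          using \<sigma> K by (intro add_left_mono mult_left_mono) auto
        finally show ?thesis
          using min[OF that] by linarith
      qed
      then have minor: "\<forall>y\<in>ball 0 (2 * R). v \<bullet> y + (u x - v \<bullet> x) \<le> truncation R u y"
        by blast
      have x2: "x \<in> ball 0 (2 * R)"
        using x(1) \<open>0 < R\<close> by simp
      show ?thesis
        using convex_envelope_le[OF minor x2] affine_le_convex_envelope[OF minor x2] ux by simp
    qed
    moreover have "x $ k \<noteq> 0"
    proof
      assume xk: "x $ k = 0"
      then have xT: "x \<in> interface k (ball 0 R)"
        using x by (simp add: interface_def)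
      have "touches_below (\<lambda>y. (u x - p \<bullet> x) + p \<bullet> y + K * \<bar>y $ k\<bar>) u x"
        unfolding touches_below_def
      proof
        have "\<forall>\<^sub>F y in nhds x. y \<in> B"
          unfolding B_def using eventually_nhds_in_open[OF open_ball x(1)] .
        then show "\<forall>\<^sub>F y in nhds x. (u x - p \<bullet> x) + p \<bullet> y + K * \<bar>y $ k\<bar> \<le> u y"
        proof eventually_elim
          case (elim y)
          then show ?case
            using support[of y] by (simp add: xk inner_diff_right algebra_simps)
        qed
      qed (simp add: xk)
      then have "transmission_min k (p + K *\<^sub>R axis k 1) (\<theta> *\<^sub>R (p - K *\<^sub>R axis k 1)) lam Lam mu \<le> g x"
        using S_upper_interface[OF u open_ball xT] by blast
      moreover have "(lam + 2 * mu) * norm p \<le> lam * K / 2"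
      proof -
        have "(lam + 2 * mu) * norm p \<le> (lam + 2 * mu) * (\<delta> * K)"
          using p lam by (intro mult_left_mono) auto
        also have "\<dots> = lam * K / 2"
          unfolding mult.assoc[symmetric] \<delta>_eq by simp
        finally show ?thesis .
      qed
      ultimately have "lam * K / 2 \<le> g x"
        using transmission_min_ge[OF lam \<theta>, of p K k] pK by linarith
      then have "24 * R / lam * (lam * K / 2) \<le> 24 * R / lam * g x"
        using lam \<open>0 < R\<close> by (intro mult_left_mono) auto
      moreover have "24 * R / lam * (lam * K / 2) = m"
        using lam by (simp add: mK)
      ultimately show False
        using g[OF xT] by linarith
    qed
    ultimately show ?thesis
      using x support unfolding B_def by blast
  qed
  \<comment> \<open>The minimum of - u_- over the closed ball, attained by semicontinuity, is a
    constant minorant.\<close>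
  have minorant: "\<exists>a0 b0. \<forall>y\<in>ball 0 (2 * R). a0 \<bullet> y + b0 \<le> truncation R u y"
  proof -
    obtain z where z: "z \<in> cball 0 R" "\<forall>y\<in>cball 0 R. - neg_part (u z) \<le> - neg_part (u y)"
      using lsc_on_attains_inf[OF compact_cball _ lsc_on_neg_part[OF lsc]] \<open>0 < R\<close> by auto
    have "(0 :: real ^ 'n) \<bullet> y + - neg_part (u z) \<le> truncation R u y" for y
      using z(2) by (cases "y \<in> ball 0 R") (auto simp: neg_part_def)
    then show ?thesis by blast
  qed
  have lscB: "lsc_on B u"
    using lsc_on_subset[OF lsc] by (simp add: B_def ball_subset_cball)
  have borelB: "B \<inter> ?A \<in> sets borel"
    using minorant contact_set_borel[OF \<open>0 < R\<close>, of u] lscB unfolding B_def by blast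
  have up: "open (upper_part k B)" and lo: "open (lower_part k B)"
    by (simp_all add: B_def open_upper_part open_lower_part)
  have sub: "upper_part k B \<subseteq> B" "lower_part k B \<subseteq> B"
    by (auto simp: upper_part_def lower_part_def)
  have Ap: "?A \<inter> upper_part k B \<in> sets borel" and Am: "?A \<inter> lower_part k B \<in> sets borel"
  proof -
    have "?A \<inter> upper_part k B = (B \<inter> ?A) \<inter> upper_part k B"
      "?A \<inter> lower_part k B = (B \<inter> ?A) \<inter> lower_part k B"
      using sub by auto
    then show "?A \<inter> upper_part k B \<in> sets borel" "?A \<inter> lower_part k B \<in> sets borel"
      using borelB borel_open[OF up] borel_open[OF lo] by (metis sets.Int)+
  qed
  have bdd: "bounded (upper_part k B)" "bounded (lower_part k B)"
    using sub bounded_subset[of B] by (auto simp: B_def)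
  \<comment> \<open>Within one phase the absolute value of coordinate k is linear, so there the
    wedge is a plane. It supports u at x in that phase only, which is all that
    \<open>support_slopes\<close> asks for.\<close>
  have slopes: "p + K *\<^sub>R e \<in> support_slopes u (upper_part k B) (?A \<inter> upper_part k B) \<or>
      p - K *\<^sub>R e \<in> support_slopes u (lower_part k B) (?A \<inter> lower_part k B)"
    if "p \<in> ball 0 (\<delta> * K)" for p
  proof -
    have "norm p < \<delta> * K"
      using that by simp
    then obtain x where x: "x \<in> B" "x $ k \<noteq> 0" "u x = convex_envelope R u x"
      and support: "\<And>y. y \<in> B \<Longrightarrow> u x + p \<bullet> (y - x) + K * (\<bar>y $ k\<bar> - \<bar>x $ k\<bar>) \<le> u y"
      using contact by blast
    show ?thesis
    proof (cases "x $ k > 0")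
      case True
      have "u x + (p + K *\<^sub>R e) \<bullet> (y - x) \<le> u y" if "y \<in> upper_part k B" for y
        using support[of y] that True
        by (simp add: upper_part_def e_def inner_add_left inner_axis')
      then show ?thesis
        using x True unfolding support_slopes_def upper_part_def by blast
    next
      case False
      then have neg: "x $ k < 0" using x by simp
      have "u x + (p - K *\<^sub>R e) \<bullet> (y - x) \<le> u y" if "y \<in> lower_part k B" for y
        using support[of y] that neg
        by (simp add: lower_part_def e_def inner_diff_left inner_axis' algebra_simps)
      then show ?thesis
        using x neg unfolding support_slopes_def lower_part_def by blast
    qed
  qed
  have C: "C \<ge> 0"
    using slope_volume_nonneg[OF lam(1)] by (simp add: C_def)
  have bound: "\<omega> * (\<delta> * K) ^ n \<le> C * (a ^ n + b ^ n) + \<epsilon>'" if "0 < \<epsilon>'" for \<epsilon>'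
  proof -
    \<comment> \<open>Each of the two coverings has an error C \<epsilon>. Dividing by C + 1 is safe
      because only C \<ge> 0 has been recorded.\<close>
    define \<epsilon> where "\<epsilon> = \<epsilon>' / (2 * (C + 1))"
    have \<epsilon>: "\<epsilon> > 0" "C * (2 * \<epsilon>) \<le> \<epsilon>'"
      using that C by (auto simp: \<epsilon>_def field_simps)
    obtain Dp where Dp: "Dp \<in> sets lborel" "support_slopes u (upper_part k B) (?A \<inter> upper_part k B) \<subseteq> Dp"
      "emeasure lborel Dp \<le> ennreal C * (ennreal (a ^ n) + ennreal \<epsilon>)"
      using support_slopes_cover[OF lam(1,2) S_upper_pucci_supersolution(1)[OF u open_ball]
          lsc_on_subset[OF lscB sub(1), unfolded B_def] up[unfolded B_def] bdd(1)[unfolded B_def] _ Ap[unfolded B_def] fp \<epsilon>(1)]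
      unfolding Ip C_def n_def B_def by auto
    obtain Dm where Dm: "Dm \<in> sets lborel" "support_slopes u (lower_part k B) (?A \<inter> lower_part k B) \<subseteq> Dm"
      "emeasure lborel Dm \<le> ennreal C * (ennreal (b ^ n) + ennreal \<epsilon>)"
      using support_slopes_cover[OF lam(1,2) S_upper_pucci_supersolution(2)[OF u open_ball]
          lsc_on_subset[OF lscB sub(2), unfolded B_def] lo[unfolded B_def] bdd(2)[unfolded B_def] _ Am[unfolded B_def] fm \<epsilon>(1)]
      unfolding Im C_def n_def B_def by auto
    have "ennreal (\<omega> * (\<delta> * K) ^ n) = emeasure lborel (ball (0 :: real ^ 'n) (\<delta> * K))"
      using \<delta> K by (simp add: emeasure_ball \<omega>_def n_def)
    also have "\<dots> \<le> emeasure lborel Dp + emeasure lborel Dm"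
      using slopes Dp(2) Dm(2) by (intro emeasure_ball_le_translates[OF Dp(1) Dm(1), of _ "K *\<^sub>R e"]) blast
    also have "\<dots> \<le> ennreal C * (ennreal (a ^ n) + ennreal \<epsilon>) + ennreal C * (ennreal (b ^ n) + ennreal \<epsilon>)"
      by (intro add_mono Dp Dm)
    also have "\<dots> = ennreal (C * (a ^ n + \<epsilon>) + C * (b ^ n + \<epsilon>))"
      using C \<epsilon> Ip(2) Im(2) by (simp add: ennreal_plus[symmetric] ennreal_mult'[symmetric] del: ennreal_plus)
    finally have "\<omega> * (\<delta> * K) ^ n \<le> C * (a ^ n + \<epsilon>) + C * (b ^ n + \<epsilon>)"
      using C \<epsilon> Ip(2) Im(2) by (subst (asm) ennreal_le_iff) auto
    also have "\<dots> = C * (a ^ n + b ^ n) + C * (2 * \<epsilon>)"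
      by (simp add: algebra_simps)
    finally show ?thesis
      using \<epsilon>(2) by linarith
  qed
  have "\<omega> * (\<delta> * K) ^ n \<le> C * (a ^ n + b ^ n)"
    using bound by (rule field_le_epsilon)
  \<comment> \<open>Superadditivity of the n-th power merges the phases, so that a single n-th root
    yields the sum of the two norms.\<close>
  also have "\<dots> \<le> C * (a + b) ^ n"
    using C add_power_superadditive[OF Ip(2) Im(2) n] by (rule mult_left_mono[rotated])
  also have "\<dots> = \<omega> * (16 * (real n)\<^sup>2 / lam * 2 * (a + b)) ^ n"
    unfolding C_def slope_volume_def \<omega>_def power_mult_distrib by simp
  also have "16 * (real n)\<^sup>2 / lam * 2 * (a + b) = 32 * (real n)\<^sup>2 / lam * (a + b)"
    by simp
  finally have "(\<delta> * K) ^ n \<le> (32 * (real n)\<^sup>2 / lam * (a + b)) ^ n"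
    using \<omega> by simp
  then have "\<delta> * K \<le> 32 * (real n)\<^sup>2 / lam * (a + b)"
    by (rule power_mono_iff[THEN iffD1, rotated -1]) (use n \<delta> K lam Ip(2) Im(2) in auto)
  then have "12 * R / \<delta> * (\<delta> * K) \<le> 12 * R / \<delta> * (32 * (real n)\<^sup>2 / lam * (a + b))"
    using \<delta> \<open>0 < R\<close> by (intro mult_left_mono) auto
  moreover have "12 * R / \<delta> * (\<delta> * K) = m"
    using \<delta> by (simp add: mK)
  moreover have "12 * R / \<delta> = 24 * R * (lam + 2 * mu) / lam"
    by (simp add: \<delta>_def)
  then have "12 * R / \<delta> * (32 * (real n)\<^sup>2 / lam * (a + b))
      = 768 * (real n)\<^sup>2 * (lam + 2 * mu) / lam\<^sup>2 * R * (a + b)"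
    by (simp add: power2_eq_square[of lam])
  ultimately show ?thesis
    unfolding n_def by simp
qed

section \<open>Passage to norms with values in the extended reals\<close>

lemma Lp_norm_finite:
  assumes "Lp_norm n E h \<noteq> \<infinity>" "0 < n"
  obtains a where "0 \<le> a" "Lp_norm n E h = ennreal a"
    "(\<integral>\<^sup>+x\<in>E. ennreal (\<bar>h x\<bar> ^ n) \<partial>lborel) = ennreal (a ^ n)"
proof
  let ?I = "\<integral>\<^sup>+x\<in>E. ennreal (\<bar>h x\<bar> ^ n) \<partial>lborel"
  have fin: "?I \<noteq> \<infinity>"
    using assms(1) by (auto simp: Lp_norm_def)
  then show "Lp_norm n E h = ennreal (root n (enn2real ?I))"
    by (simp add: Lp_norm_def)
  show "0 \<le> root n (enn2real ?I)"
    by (intro real_root_ge_zero enn2real_nonneg)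
  show "?I = ennreal (root n (enn2real ?I) ^ n)"
    using fin assms(2) by (simp add: real_root_pow_pos2 less_top)
qed

theorem theorem3p1:
  fixes lam Lam mu :: real
  assumes "0 < lam" and "lam \<le> Lam" and "0 \<le> mu"
  shows "\<exists>C>0. \<forall>(k::'n::finite) (R::real) (\<theta>::real)
           (fp :: real ^ 'n \<Rightarrow> real) (fm :: real ^ 'n \<Rightarrow> real) (g :: real ^ 'n \<Rightarrow> real)
           (u :: real ^ 'n \<Rightarrow> real).
     0 < R \<longrightarrow> 0 \<le> \<theta> \<longrightarrow> \<theta> \<le> 1 \<longrightarrow>
     continuous_on (upper_part k (ball 0 R) \<union> interface k (ball 0 R)) fp \<longrightarrow>
     continuous_on (lower_part k (ball 0 R) \<union> interface k (ball 0 R)) fm \<longrightarrow>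
     continuous_on (interface k (ball 0 R)) g \<longrightarrow>
     u \<in> S_upper k lam Lam mu \<theta> fp fm g (ball 0 R) \<longrightarrow>
     lsc_on (closure (ball 0 R)) u \<longrightarrow>
     (SUP x\<in>ball 0 R. ennreal (neg_part (u x)))
       \<le> (SUP x\<in>frontier (ball 0 R). ennreal (neg_part (u x)))
         + ennreal (C * R) *
           (Lp_norm CARD('n) ({x. u x = convex_envelope R u x} \<inter> upper_part k (ball 0 R))
              (\<lambda>x. pos_part (fp x))
            + Lp_norm CARD('n) ({x. u x = convex_envelope R u x} \<inter> lower_part k (ball 0 R))
                (\<lambda>x. pos_part (fm x))
            + Linf_norm (hyperplane_measure k) (interface k (ball 0 R)) (\<lambda>x. pos_part (g x)))"
proof -
  define C1 where "C1 = 768 * (real CARD('n))\<^sup>2 * (lam + 2 * mu) / lam\<^sup>2"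
  \<comment> \<open>\<open>C1\<close> serves contact in the phases and 24 / \<lambda> contact on the
    interface.\<close>
  define C where "C = C1 + 24 / lam"
  have C1: "C1 \<ge> 0"
    using assms by (simp add: C1_def)
  have C: "C > 0"
    using assms C1 by (simp add: C_def add_nonneg_pos)
  show ?thesis
  proof (intro exI[of _ C] conjI allI impI C)
    fix k :: 'n and R \<theta> :: real and fp fm g u :: "real ^ 'n \<Rightarrow> real"
    assume R: "0 < R" and \<theta>: "0 \<le> \<theta>" "\<theta> \<le> 1"
      and fp: "continuous_on (upper_part k (ball 0 R) \<union> interface k (ball 0 R)) fp"
      and fm: "continuous_on (lower_part k (ball 0 R) \<union> interface k (ball 0 R)) fm"
      and g: "continuous_on (interface k (ball 0 R)) g"
      and u: "u \<in> S_upper k lam Lam mu \<theta> fp fm g (ball 0 R)"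
      and lsc: "lsc_on (closure (ball 0 R)) u"
    define S where "S = (SUP x\<in>frontier (ball 0 R). ennreal (neg_part (u x)))"
    define Np where "Np = Lp_norm CARD('n) ({x. u x = convex_envelope R u x} \<inter> upper_part k (ball 0 R))
              (\<lambda>x. pos_part (fp x))"
    define Nm where "Nm = Lp_norm CARD('n) ({x. u x = convex_envelope R u x} \<inter> lower_part k (ball 0 R))
              (\<lambda>x. pos_part (fm x))"
    define G where "G = Linf_norm (hyperplane_measure k) (interface k (ball 0 R)) (\<lambda>x. pos_part (g x))"
    have "ennreal (neg_part (u x0)) \<le> S + ennreal (C * R) * (Np + Nm + G)" if x0: "x0 \<in> ball 0 R" for x0
    \<comment> \<open>An infinite norm makes the right-hand side infinite because C R > 0.
      \<open>G\<close> may stay infinite in the other case, as it enters only as an upper bound for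
      values of g.\<close>
    proof (cases "S = \<infinity> \<or> Np = \<infinity> \<or> Nm = \<infinity>")
      case True
      then show ?thesis
        using C R by (auto simp: ennreal_mult_top)
    next
      case False
      define s where "s = enn2real S"
      have S: "S = ennreal s" "0 \<le> s"
        using False by (auto simp: s_def less_top)
      have s: "neg_part (u x) \<le> s" if "x \<in> sphere 0 R" for x
      proof -
        have "ennreal (neg_part (u x)) \<le> ennreal s"
          unfolding S(1)[symmetric] S_def using that R by (intro SUP_upper) (simp add: frontier_ball)
        then show ?thesis
          using S(2) by simp
      qed
      have pos: "\<bar>pos_part t\<bar> = pos_part t" for t
        by (simp add: pos_part_def)
      obtain a where a: "0 \<le> a" "Np = ennreal a"
        "(\<integral>\<^sup>+x\<in>{x. u x = convex_envelope R u x} \<inter> upper_part k (ball 0 R).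
           ennreal (pos_part (fp x) ^ CARD('n)) \<partial>lborel) = ennreal (a ^ CARD('n))"
        using Lp_norm_finite[of "CARD('n)" "{x. u x = convex_envelope R u x} \<inter> upper_part k (ball 0 R)"
            "\<lambda>x. pos_part (fp x)"] False unfolding Np_def pos by auto
      obtain b where b: "0 \<le> b" "Nm = ennreal b"
        "(\<integral>\<^sup>+x\<in>{x. u x = convex_envelope R u x} \<inter> lower_part k (ball 0 R).
           ennreal (pos_part (fm x) ^ CARD('n)) \<partial>lborel) = ennreal (b ^ CARD('n))"
        using Lp_norm_finite[of "CARD('n)" "{x. u x = convex_envelope R u x} \<inter> lower_part k (ball 0 R)"
            "\<lambda>x. pos_part (fm x)"] False unfolding Nm_def pos by auto
      define m where "m = neg_part (u x0) - s"
      have m: "ennreal m \<le> ennreal (C * R) * (Np + Nm + G)"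
      \<comment> \<open>Either g is too small everywhere for interface contact at height m, and the
        phases bound m, or one interface point violates this, and its value of g alone bounds
        m.\<close>
      proof (cases "0 < m \<and> (\<forall>x\<in>interface k (ball 0 R). 24 * R / lam * g x < m)")
        case True
        have "m \<le> C1 * R * (a + b)"
          unfolding C1_def
        proof (rule transmission_abp[OF assms R \<theta>(1) _ _ u _ S(2) s x0])
          show "continuous_on (upper_part k (ball 0 R)) fp" "continuous_on (lower_part k (ball 0 R)) fm"
            using fp fm continuous_on_subset by blast+
          show "lsc_on (cball 0 R) u"
            using lsc R by (simp add: closure_ball)
        qed (use a b True in \<open>auto simp: m_def\<close>)
        also have "\<dots> \<le> C * R * (a + b)"
          using a b R assms by (intro mult_right_mono) (auto simp: C_def)
        finally have "ennreal m \<le> ennreal (C * R * (a + b))"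
          by (rule ennreal_leI)
        also have "\<dots> = ennreal (C * R) * (Np + Nm)"
          using a b C R by (simp add: ennreal_mult' ennreal_plus[symmetric] del: ennreal_plus)
        also have "\<dots> \<le> ennreal (C * R) * (Np + Nm + G)"
          by (intro mult_left_mono) auto
        finally show ?thesis .
      next
        case False
        then consider "m \<le> 0" | x where "x \<in> interface k (ball 0 R)" "m \<le> 24 * R / lam * g x"
          by fastforce
        then show ?thesis
        proof cases
          case 1
          then show ?thesis by (simp add: ennreal_neg)
        next
          case 2
          have "continuous_on (interface k (ball 0 R)) (\<lambda>x. pos_part (g x))"
            unfolding pos_part_def using g by (intro continuous_intros)
          then have gG: "ennreal (pos_part (g x)) \<le> G"
            using Linf_norm_interface_ge[OF open_ball _ 2(1), of "\<lambda>x. pos_part (g x)"]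
            by (simp add: G_def pos)
          have "m \<le> 24 * R / lam * pos_part (g x)"
            using 2(2) mult_left_mono[of "g x" "pos_part (g x)" "24 * R / lam"] R assms
            by (simp add: pos_part_def)
          also have "\<dots> \<le> C * R * pos_part (g x)"
            using C1 R by (intro mult_right_mono) (auto simp: C_def pos_part_def distrib_right)
          finally have "ennreal m \<le> ennreal (C * R * pos_part (g x))"
            by (rule ennreal_leI)
          also have "\<dots> = ennreal (C * R) * ennreal (pos_part (g x))"
            using C R by (simp add: ennreal_mult')
          also have "\<dots> \<le> ennreal (C * R) * (Np + Nm + G)"
            using gG by (intro mult_left_mono) (auto intro: order_trans)
          finally show ?thesis .
        qed
      qed
      \<comment> \<open>For negative m the coercion gives 0, and then u_- at x0 is already below
        s.\<close>
      have "ennreal (neg_part (u x0)) \<le> ennreal s + ennreal m"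
      proof (cases "0 \<le> m")
        case True
        then show ?thesis
          using S(2) by (simp add: m_def ennreal_plus[symmetric] del: ennreal_plus)
      next
        case False
        then show ?thesis
          by (intro add_increasing2) (auto simp: m_def ennreal_leI)
      qed
      then show ?thesis
        using m unfolding S(1) by (meson add_left_mono order_trans)
    qed
    then show "(SUP x\<in>ball 0 R. ennreal (neg_part (u x)))
       \<le> (SUP x\<in>frontier (ball 0 R). ennreal (neg_part (u x)))
         + ennreal (C * R) *
           (Lp_norm CARD('n) ({x. u x = convex_envelope R u x} \<inter> upper_part k (ball 0 R))
              (\<lambda>x. pos_part (fp x))
            + Lp_norm CARD('n) ({x. u x = convex_envelope R u x} \<inter> lower_part k (ball 0 R))
                (\<lambda>x. pos_part (fm x))
            + Linf_norm (hyperplane_measure k) (interface k (ball 0 R)) (\<lambda>x. pos_part (g x)))"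
      unfolding S_def Np_def Nm_def G_def by (intro SUP_least)
  qed
qed

end
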